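(* Let $\omega\in\mathbb{G}_m(\mathbb{C})_{\mathrm{tors}}$ be a root of unity, and let $\omega^*\mathcal{L}og$ be the fibre at $\omega$ of the logarithmic pro-variation $\mathcal{L}og$ on $\mathbb{G}_m$, a (pro-)mixed Tate-Hodge structure. Then $\omega^*\mathcal{L}og$ splits canonically: $$\omega^*\mathcal{L}og=\prod_{j\ge 0}\mathbb{Q}(j).$$
   Context: MHS is the category of mixed $\mathbb{Q}$-Hodge structures. Let $\pi=\pi_1(\mathbb{G}_m(\mathbb{C}),1)=\mathbb{Z}\gamma$, where $\gamma$ is the positively oriented loop around $0$, let $\mathfrak{a}$ be the augmentation ideal of $\mathbb{Q}[\pi]$, and let $\hat U=\varprojlim_n\mathbb{Q}[\pi]/\mathfrak{a}^n$. Put $e=\log\gamma\in\hat U$, so that $\hat U=\mathbb{Q}[[e]]$. By a theorem of Chen, $\hat U$ carries a unique (pro-)mixed Hodge structure such that multiplication $\hat U\otimes\hat U\to\hat U$ and the unit $\mathbb{Q}(0)\to\hat U$ are morphisms of mixed Hodge structures, and $\mathfrak{a}/\mathfrak{a}^2\cong H_1(\mathbb{G}_m(\mathbb{C}),\mathbb{Q})=\mathbb{Q}(1)$ is an isomorphism of mixed Hodge structures. Explicitly, $\hat U=\prod_{j\ge0}\mathbb{Q}(j)$, with $\mathbb{Q}(j)$ spanned by $e^j$. By the theorem of Hain–Zucker, taking the monodromy representation on the stalk at $1$ is an equivalence between admissible unipotent variations of mixed $\mathbb{Q}$-Hodge structure on $\mathbb{G}_{m}$ and mixed Hodge structures $V$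 with an action $\hat U\otimes V\to V$ that is a morphism of mixed Hodge structures. (A variation is unipotent if all $\mathrm{Gr}^W_n$ are constant.) The logarithmic sheaf $\mathcal{L}og$ is the pro-object of admissible unipotent variations on $\mathbb{G}_m$ corresponding to $\hat U$ acting on itself by multiplication. Thus its stalk at $1$ is $\prod_{j\ge 0}\mathbb{Q}(j)$, its graded pieces $\mathrm{Gr}^W_{-2j}\mathcal{L}og$ are the constant variations $\mathbb{Q}(j)$ ($j\ge0$), and all other graded pieces vanish. "Splits canonically" means that there is a canonical isomorphism of (pro-)mixed Hodge structures $\omega^*\mathcal{L}og\cong\prod_{j\ge0}\mathbb{Q}(j)=\prod_{j\ge 0}\mathrm{Gr}^W_{-2j}(\omega^*\mathcal{L}og)$. *)

theory Defs
  imports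
    "HOL-Analysis.Analysis"
    "HOL-Library.Function_Algebras"
    "HOL-Library.Set_Algebras"
    "HOL-Computational_Algebra.Formal_Power_Series"
begin

section \<open>Complex vector spaces\<close>

class complex_vector = ab_group_add +
  fixes scaleC :: "complex \<Rightarrow> 'a \<Rightarrow> 'a"  (infixr "*\<^sub>C" 75)
  assumes scaleC_add_right: "a *\<^sub>C (x + y) = a *\<^sub>C x + a *\<^sub>C y"
    and scaleC_add_left: "(a + b) *\<^sub>C x = a *\<^sub>C x + b *\<^sub>C x"
    and scaleC_scaleC: "a *\<^sub>C (b *\<^sub>C x) = (a * b) *\<^sub>C x"
    and scaleC_one: "1 *\<^sub>C x = x"

instantiation complex :: complex_vector
begin
definition scaleC_complex :: "complex \<Rightarrow> complex \<Rightarrow> complex"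
  where "scaleC_complex a x = a * x"
instance by standard (simp_all add: scaleC_complex_def algebra_simps)
end

instantiation "fun" :: (type, complex_vector) complex_vector
begin
definition scaleC_fun :: "complex \<Rightarrow> ('a \<Rightarrow> 'b) \<Rightarrow> 'a \<Rightarrow> 'b"
  where "scaleC_fun a f = (\<lambda>i. a *\<^sub>C f i)"
instance
  by standard (simp_all add: scaleC_fun_def fun_eq_iff scaleC_add_right scaleC_add_left
      scaleC_scaleC scaleC_one)
end

instantiation fps :: (complex_vector) complex_vector
begin
definition scaleC_fps :: "complex \<Rightarrow> 'a fps \<Rightarrow> 'a fps"
  where "scaleC_fps a f = Abs_fps (\<lambda>j. a *\<^sub>C fps_nth f j)"
instance
  by standard (simp_all add: scaleC_fps_def fps_eq_iff scaleC_add_right scaleC_add_left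
      scaleC_scaleC scaleC_one)
end

abbreviation scaleQ :: "rat \<Rightarrow> 'v \<Rightarrow> 'v::complex_vector"
  where "scaleQ q x \<equiv> of_rat q *\<^sub>C x"

global_interpretation cvec: vector_space "scaleC :: complex \<Rightarrow> 'v \<Rightarrow> 'v::complex_vector"
  by standard (simp_all add: scaleC_add_right scaleC_add_left scaleC_scaleC scaleC_one)

global_interpretation qvec: vector_space "scaleQ :: rat \<Rightarrow> 'v \<Rightarrow> 'v::complex_vector"
  by standard (simp_all add: scaleC_add_right scaleC_add_left scaleC_scaleC scaleC_one
      of_rat_add of_rat_mult)


section \<open>Mixed rational Hodge structures\<close>

text \<open>
  A finite-dimensional rational vector space \<open>V\<close> is given together with its complexification as a
  rational subspace \<open>V\<close> of a complex vector space that is spanned over the rationals by finitely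
  many vectors linearly independent over the complex numbers; thus \<open>V \<otimes> \<complex>\<close> is the complex span
  of \<open>V\<close>, and likewise for rational subspaces of \<open>V\<close>. \<open>wt M k\<close> is \<open>W\<^sub>k\<close> and \<open>hdg M p\<close> is \<open>F\<^sup>p\<close>.
\<close>

record 'v mhs =
  lattice :: "'v set"
  wt :: "int \<Rightarrow> 'v set"
  hdg :: "int \<Rightarrow> 'v set"

definition cx :: "'v::complex_vector mhs \<Rightarrow> 'v set"
  where "cx M = cvec.span (lattice M)"

definition wtC :: "'v::complex_vector mhs \<Rightarrow> int \<Rightarrow> 'v set"
  where "wtC M k = cvec.span (wt M k)"

text \<open>The image of \<open>S \<subseteq> V \<otimes> \<complex>\<close> under complex conjugation with respect to \<open>V\<close>.\<close>

definition conj_set :: "'v::complex_vector set \<Rightarrow> 'v set \<Rightarrow> 'v set"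
  where "conj_set V S = {\<Sum>b\<in>B. cnj (c b) *\<^sub>C b | B c.
           finite B \<and> B \<subseteq> V \<and> (\<Sum>b\<in>B. c b *\<^sub>C b) \<in> S}"

text \<open>
  The preimage in \<open>W\<^sub>k \<otimes> \<complex>\<close> of the subspace \<open>F\<^sup>p\<close> of
  \<open>(Gr\<^sup>W\<^sub>k V) \<otimes> \<complex> = (W\<^sub>k \<otimes> \<complex>) / (W\<^sub>k\<^sub>-\<^sub>1 \<otimes> \<complex>)\<close>. Statements about
  graded pieces are written below in terms of such preimages.
\<close>

definition gr_hdg :: "'v::complex_vector mhs \<Rightarrow> int \<Rightarrow> int \<Rightarrow> 'v set"
  where "gr_hdg M k p = (hdg M p \<inter> wtC M k) + wtC M (k - 1)"

text \<open>A finite exhaustive and separated increasing filtration by rational subspaces.\<close>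

definition rat_filtration :: "'v::complex_vector set \<Rightarrow> (int \<Rightarrow> 'v set) \<Rightarrow> bool"
  where "rat_filtration V W \<longleftrightarrow>
    (\<forall>k. qvec.subspace (W k) \<and> W k \<subseteq> W (k + 1) \<and> W k \<subseteq> V) \<and>
    (\<exists>a. W a = {0}) \<and> (\<exists>b. W b = V)"

text \<open>
  The last condition says that \<open>Gr\<^sup>W\<^sub>k\<close> is a pure Hodge structure of weight \<open>k\<close>, i.e.
  \<open>(Gr\<^sup>W\<^sub>k) \<otimes> \<complex>\<close> is the direct sum of \<open>F\<^sup>p\<close> and the conjugate of \<open>F\<^sup>k\<^sup>+\<^sup>1\<^sup>-\<^sup>p\<close>, for all \<open>p\<close>.
\<close>

definition mixed_hodge_structure :: "'v::complex_vector mhs \<Rightarrow> bool"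
  where "mixed_hodge_structure M \<longleftrightarrow>
    (\<exists>B. finite B \<and> cvec.independent B \<and> lattice M = qvec.span B) \<and>
    rat_filtration (lattice M) (wt M) \<and>
    (\<forall>p. cvec.subspace (hdg M p) \<and> hdg M (p + 1) \<subseteq> hdg M p \<and> hdg M p \<subseteq> cx M) \<and>
    (\<exists>a. hdg M a = cx M) \<and> (\<exists>b. hdg M b = {0}) \<and>
    (\<forall>k p. gr_hdg M k p + conj_set (lattice M) (gr_hdg M k (k + 1 - p)) = wtC M k \<and>
           gr_hdg M k p \<inter> conj_set (lattice M) (gr_hdg M k (k + 1 - p)) = wtC M (k - 1))"

definition clinear_on :: "'v::complex_vector set \<Rightarrow> ('v \<Rightarrow> 'w::complex_vector) \<Rightarrow> bool"
  where "clinear_on S f \<longleftrightarrow>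
    (\<forall>x\<in>S. \<forall>y\<in>S. f (x + y) = f x + f y) \<and> (\<forall>a. \<forall>x\<in>S. f (a *\<^sub>C x) = a *\<^sub>C f x)"

definition mhs_hom ::
    "'v::complex_vector mhs \<Rightarrow> 'w::complex_vector mhs \<Rightarrow> ('v \<Rightarrow> 'w) \<Rightarrow> bool"
  where "mhs_hom M N f \<longleftrightarrow>
    clinear_on (cx M) f \<and> f ` lattice M \<subseteq> lattice N \<and>
    (\<forall>k. f ` wt M k \<subseteq> wt N k) \<and> (\<forall>p. f ` hdg M p \<subseteq> hdg N p)"

definition mhs_iso ::
    "'v::complex_vector mhs \<Rightarrow> 'w::complex_vector mhs \<Rightarrow> ('v \<Rightarrow> 'w) \<Rightarrow> bool"
  where "mhs_iso M N f \<longleftrightarrow>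
    mhs_hom M N f \<and>
    (\<exists>g. mhs_hom N M g \<and> (\<forall>x\<in>cx M. g (f x) = x) \<and> (\<forall>y\<in>cx N. f (g y) = y))"

text \<open>
  The Tate structure \<open>\<rat>(j)\<close>, of type \<open>(-j,-j)\<close>, with the generator \<open>(2\<pi>i)\<^sup>j\<close> of its rational
  lattice normalized to \<open>1\<close>.
\<close>

definition tate :: "nat \<Rightarrow> complex mhs"
  where "tate j = \<lparr>lattice = \<rat>,
    wt = (\<lambda>k. if - 2 * int j \<le> k then \<rat> else {0}),
    hdg = (\<lambda>p. if p \<le> - int j then UNIV else {0})\<rparr>"

text \<open>Direct sum over \<open>I\<close> of a family of mixed Hodge structures.\<close>

definition family_sum :: "'i set \<Rightarrow> ('i \<Rightarrow> 'v::complex_vector set) \<Rightarrow> ('i \<Rightarrow> 'v) set"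
  where "family_sum I S = {f. (\<forall>i\<in>I. f i \<in> S i) \<and> (\<forall>i. i \<notin> I \<longrightarrow> f i = 0)}"

definition mhs_sum :: "'i set \<Rightarrow> ('i \<Rightarrow> 'v::complex_vector mhs) \<Rightarrow> ('i \<Rightarrow> 'v) mhs"
  where "mhs_sum I M = \<lparr>lattice = family_sum I (\<lambda>i. lattice (M i)),
    wt = (\<lambda>k. family_sum I (\<lambda>i. wt (M i) k)),
    hdg = (\<lambda>p. family_sum I (\<lambda>i. hdg (M i) p))\<rparr>"

text \<open>
  The pro-mixed Hodge structure \<open>\<Prod>\<^sub>j \<rat>(j)\<close> is the inverse system of the \<open>tate_sum n\<close>, with
  transition maps the projections \<open>tate_proj n\<close> from level \<open>n + 1\<close> to level \<open>n\<close>.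
\<close>

definition tate_sum :: "nat \<Rightarrow> (nat \<Rightarrow> complex) mhs"
  where "tate_sum n = mhs_sum {..n} tate"

definition tate_proj :: "nat \<Rightarrow> (nat \<Rightarrow> complex) \<Rightarrow> nat \<Rightarrow> complex"
  where "tate_proj n f = (\<lambda>j. if j \<le> n then f j else 0)"


section \<open>Variations of mixed Hodge structure on the punctured plane\<close>

text \<open>
  The underlying local system is given by its fibres and by parallel transport along paths,
  i.e. as a representation of the fundamental groupoid; \<open>transp V g\<close> is only meaningful on the
  complexified fibre at the initial point of \<open>g\<close>.
\<close>

record 'v variation =
  fibre :: "complex \<Rightarrow> 'v mhs"
  transp :: "(real \<Rightarrow> complex) \<Rightarrow> 'v \<Rightarrow> 'v"

definition Gm_path :: "(real \<Rightarrow> complex) \<Rightarrow> bool"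
  where "Gm_path g \<longleftrightarrow> path g \<and> path_image g \<subseteq> - {0}"

definition filtered_local_system :: "'v::complex_vector variation \<Rightarrow> bool"
  where "filtered_local_system V \<longleftrightarrow>
    (\<forall>g. Gm_path g \<longrightarrow>
       (let A = fibre V (pathstart g); B = fibre V (pathfinish g) in
         clinear_on (cx A) (transp V g) \<and> bij_betw (transp V g) (cx A) (cx B) \<and>
         transp V g ` lattice A = lattice B \<and> (\<forall>k. transp V g ` wt A k = wt B k))) \<and>
    (\<forall>g h. homotopic_paths (- {0}) g h \<longrightarrow>
       (\<forall>x\<in>cx (fibre V (pathstart g)). transp V g x = transp V h x)) \<and>
    (\<forall>g h. Gm_path g \<longrightarrow> Gm_path h \<longrightarrow> pathfinish g = pathstart h \<longrightarrow>
       (\<forall>x\<in>cx (fibre V (pathstart g)). transp V (g +++ h) x = transp V h (transp V g x)))"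

text \<open>
  \<open>S\<close> is a holomorphic subbundle over \<open>U\<close> of a constant bundle: it has a frame whose
  coefficients with respect to finitely many constant sections are holomorphic.
\<close>

definition hol_section :: "complex set \<Rightarrow> (complex \<Rightarrow> 'v::complex_vector) \<Rightarrow> bool"
  where "hol_section U s \<longleftrightarrow>
    (\<exists>B c. finite B \<and> (\<forall>b\<in>B. c b holomorphic_on U) \<and> (\<forall>z\<in>U. s z = (\<Sum>b\<in>B. c b z *\<^sub>C b)))"

definition hol_subbundle :: "complex set \<Rightarrow> (complex \<Rightarrow> 'v::complex_vector set) \<Rightarrow> bool"
  where "hol_subbundle U S \<longleftrightarrow>
    (\<exists>m s. (\<forall>i<m. hol_section U (s i)) \<and>
       (\<forall>z\<in>U. inj_on (\<lambda>i. s i z) {..<m} \<and> cvec.independent ((\<lambda>i. s i z) ` {..<m}) \<and>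
              S z = cvec.span ((\<lambda>i. s i z) ` {..<(m::nat)})))"

text \<open>
  \<open>F\<^sup>p\<close> at a point \<open>z\<close> of a disc around \<open>a\<close>, carried back to the fibre at \<open>a\<close> by the flat
  trivialization of the local system over the disc.
\<close>

definition flat_hdg :: "'v::complex_vector variation \<Rightarrow> complex \<Rightarrow> int \<Rightarrow> complex \<Rightarrow> 'v set"
  where "flat_hdg V a p z = {v \<in> cx (fibre V a). transp V (linepath a z) v \<in> hdg (fibre V z) p}"

text \<open>
  In the flat trivialization the flat connection is \<open>d\<close>; the last condition is Griffiths
  transversality.
\<close>

definition vmhs :: "'v::complex_vector variation \<Rightarrow> bool"
  where "vmhs V \<longleftrightarrow>
    filtered_local_system V \<and>
    (\<forall>z. z \<noteq> 0 \<longrightarrow> mixed_hodge_structure (fibre V z)) \<and>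
    (\<forall>a p. a \<noteq> 0 \<longrightarrow>
       (\<exists>r>0. 0 \<notin> ball a r \<and> hol_subbundle (ball a r) (flat_hdg V a p))) \<and>
    (\<forall>a r p B c. 0 \<notin> ball a r \<longrightarrow> finite B \<longrightarrow> B \<subseteq> cx (fibre V a) \<longrightarrow>
       (\<forall>b\<in>B. c b holomorphic_on ball a r) \<longrightarrow>
       (\<forall>z\<in>ball a r. (\<Sum>b\<in>B. c b z *\<^sub>C b) \<in> flat_hdg V a p z) \<longrightarrow>
       (\<forall>z\<in>ball a r. (\<Sum>b\<in>B. deriv (c b) z *\<^sub>C b) \<in> flat_hdg V a (p - 1) z))"

text \<open>All \<open>Gr\<^sup>W\<^sub>k\<close> are constant variations.\<close>

definition unipotent_vmhs :: "'v::complex_vector variation \<Rightarrow> bool"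
  where "unipotent_vmhs V \<longleftrightarrow> vmhs V \<and>
    (\<forall>g h k. Gm_path g \<longrightarrow> Gm_path h \<longrightarrow>
       pathstart g = pathstart h \<longrightarrow> pathfinish g = pathfinish h \<longrightarrow>
       (\<forall>v\<in>wt (fibre V (pathstart g)) k.
          transp V g v - transp V h v \<in> wt (fibre V (pathfinish g)) (k - 1))) \<and>
    (\<forall>g k p. Gm_path g \<longrightarrow>
       transp V g ` gr_hdg (fibre V (pathstart g)) k p = gr_hdg (fibre V (pathfinish g)) k p)"

definition vmhs_hom ::
    "'v::complex_vector variation \<Rightarrow> 'w::complex_vector variation \<Rightarrow> (complex \<Rightarrow> 'v \<Rightarrow> 'w) \<Rightarrow> bool"
  where "vmhs_hom V V' f \<longleftrightarrow>
    (\<forall>z. z \<noteq> 0 \<longrightarrow> mhs_hom (fibre V z) (fibre V' z) (f z)) \<and>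
    (\<forall>g. Gm_path g \<longrightarrow> (\<forall>x\<in>cx (fibre V (pathstart g)).
       f (pathfinish g) (transp V g x) = transp V' g (f (pathstart g) x)))"


section \<open>Admissibility of unipotent variations\<close>

text \<open>
  Logarithm of a unipotent and exponential of a nilpotent operator: on vectors where the
  operator \<open>T - 1\<close>, resp. \<open>N\<close>, is locally nilpotent, the series below are finite sums containing
  all their non-zero terms.
\<close>

definition ulog :: "('v \<Rightarrow> 'v) \<Rightarrow> 'v \<Rightarrow> 'v::complex_vector"
  where "ulog T v = (\<Sum>k | 0 < k \<and> ((\<lambda>x. T x - x) ^^ k) v \<noteq> 0.
           ((- 1) ^ (k + 1) / of_nat k) *\<^sub>C ((\<lambda>x. T x - x) ^^ k) v)"

definition nexp :: "('v \<Rightarrow> 'v) \<Rightarrow> 'v \<Rightarrow> 'v::complex_vector"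
  where "nexp N v = (\<Sum>k | (N ^^ k) v \<noteq> 0. (1 / fact k) *\<^sub>C (N ^^ k) v)"

text \<open>The generator of the fundamental group of the punctured plane at \<open>1\<close>.\<close>

definition gamma_loop :: "real \<Rightarrow> complex"
  where "gamma_loop t = exp (of_real (2 * pi * t) * \<i>)"

definition log_monodromy :: "'v::complex_vector variation \<Rightarrow> 'v \<Rightarrow> 'v"
  where "log_monodromy V = ulog (transp V gamma_loop)"

text \<open>
  For unipotent monodromy with logarithm \<open>N\<close>, the canonical extension across \<open>0\<close> is framed by the
  single-valued sections \<open>exp (- (log z / 2\<pi>i) N) v\<close>, where \<open>v\<close> is a multivalued flat section. The
  value at \<open>z\<close> does not depend on the branch of \<open>log z\<close>, which is also used to choose the path
  from \<open>1\<close> to \<open>z\<close>.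
\<close>

definition canonical_frame :: "'v::complex_vector variation \<Rightarrow> complex \<Rightarrow> 'v \<Rightarrow> 'v"
  where "canonical_frame V z v =
    transp V (\<lambda>t. exp (of_real t * Ln z))
      (nexp (\<lambda>x. (- (Ln z / (2 * of_real pi * \<i>))) *\<^sub>C log_monodromy V x) v)"

text \<open>
  \<open>M\<close> is the weight filtration of \<open>N\<close> relative to \<open>W\<close>: \<open>N\<close> maps \<open>M\<^sub>k\<close> to \<open>M\<^sub>k\<^sub>-\<^sub>2\<close>, and \<open>N\<^sup>i\<close> induces
  isomorphisms from \<open>Gr\<^sup>M\<^sub>k\<^sub>+\<^sub>i Gr\<^sup>W\<^sub>k\<close> to \<open>Gr\<^sup>M\<^sub>k\<^sub>-\<^sub>i Gr\<^sup>W\<^sub>k\<close>.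
\<close>

definition relative_weight_filtration ::
    "'v::complex_vector set \<Rightarrow> (int \<Rightarrow> 'v set) \<Rightarrow> ('v \<Rightarrow> 'v) \<Rightarrow> (int \<Rightarrow> 'v set) \<Rightarrow> bool"
  where "relative_weight_filtration H W N M \<longleftrightarrow>
    rat_filtration H M \<and> (\<forall>k. N ` M k \<subseteq> M (k - 2)) \<and>
    (\<forall>k (i::nat). let P = (\<lambda>m. (M m \<inter> W k) + W (k - 1)) in
       (\<forall>v\<in>P (k + int i). (N ^^ i) v \<in> P (k - int i - 1) \<longrightarrow> v \<in> P (k + int i - 1)) \<and>
       P (k - int i) \<subseteq> (N ^^ i) ` P (k + int i) + P (k - int i - 1))"

text \<open>
  The Hodge filtration extends to a filtration (with limit \<open>L p\<close> at the puncture) of the canonical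
  extension by subbundles with locally free \<open>Gr\<^sub>F Gr\<^sup>W\<close>, i.e. such that the \<open>F\<^sup>p \<inter> W\<^sub>k\<close> extend
  compatibly to subbundles; and the relative weight filtration exists.
\<close>

definition admissible_at_0 :: "'v::complex_vector variation \<Rightarrow> bool"
  where "admissible_at_0 V \<longleftrightarrow>
    (\<exists>L r. r > 0 \<and> (\<forall>p k. hol_subbundle (ball 0 r)
       (\<lambda>z. if z = 0 then L p \<inter> wtC (fibre V 1) k
            else {v \<in> cx (fibre V 1).
                    canonical_frame V z v \<in> hdg (fibre V z) p \<inter> wtC (fibre V z) k}))) \<and>
    (\<exists>M. relative_weight_filtration (lattice (fibre V 1)) (wt (fibre V 1)) (log_monodromy V) M)"

definition pullback :: "(complex \<Rightarrow> complex) \<Rightarrow> 'v variation \<Rightarrow> 'v variation"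
  where "pullback f V = \<lparr>fibre = (\<lambda>z. fibre V (f z)), transp = (\<lambda>g. transp V (f \<circ> g))\<rparr>"

text \<open>Admissibility at \<open>\<infinity>\<close> is admissibility at \<open>0\<close> in the coordinate \<open>1/z\<close>.\<close>

definition admissible_unipotent :: "'v::complex_vector variation \<Rightarrow> bool"
  where "admissible_unipotent V \<longleftrightarrow>
    unipotent_vmhs V \<and> admissible_at_0 V \<and> admissible_at_0 (pullback inverse V)"


section \<open>The logarithmic sheaf\<close>

text \<open>
  The pro-mixed Hodge structure on \<open>\<rat>[[e]] = \<Prod>\<^sub>j \<rat>(j)\<close>, with \<open>\<rat>(j)\<close> spanned by \<open>e\<^sup>j\<close>, is the inverse
  system of the quotients by the powers \<open>(e\<^sup>n\<^sup>+\<^sup>1)\<close> of the augmentation ideal. A class modulo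
  \<open>e\<^sup>n\<^sup>+\<^sup>1\<close> is represented by its truncation (\<^const>\<open>fps_cutoff\<close>); here \<open>e\<close> is \<^const>\<open>fps_X\<close>, and the loop
  \<open>\<gamma> = exp e\<close> acts by multiplication.
\<close>

definition Uhat :: "nat \<Rightarrow> complex fps mhs"
  where "Uhat n = \<lparr>lattice = Abs_fps ` lattice (tate_sum n),
    wt = (\<lambda>k. Abs_fps ` wt (tate_sum n) k),
    hdg = (\<lambda>p. Abs_fps ` hdg (tate_sum n) p)\<rparr>"

definition Uhat_gamma :: "nat \<Rightarrow> complex fps \<Rightarrow> complex fps"
  where "Uhat_gamma n u = fps_cutoff (Suc n) (fps_exp 1 * u)"

text \<open>
  The logarithmic sheaf is the pro-object \<open>L 0, L 1, \<dots>\<close> (with transition morphisms \<open>q n\<close> from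
  \<open>L (n + 1)\<close> to \<open>L n\<close>) of admissible unipotent variations whose stalk at \<open>1\<close>, with its monodromy
  representation, is identified by \<open>\<iota>\<close> with \<open>Uhat\<close> acting on itself by multiplication. By the
  theorem of Hain and Zucker these data exist and are unique up to unique isomorphism.
\<close>

definition logarithmic_sheaf ::
    "(nat \<Rightarrow> 'v::complex_vector variation) \<Rightarrow> (nat \<Rightarrow> complex \<Rightarrow> 'v \<Rightarrow> 'v) \<Rightarrow>
     (nat \<Rightarrow> complex fps \<Rightarrow> 'v) \<Rightarrow> bool"
  where "logarithmic_sheaf L q \<iota> \<longleftrightarrow>
    (\<forall>n. admissible_unipotent (L n)) \<and>
    (\<forall>n. vmhs_hom (L (Suc n)) (L n) (q n)) \<and>
    (\<forall>n. mhs_iso (Uhat n) (fibre (L n) 1) (\<iota> n)) \<and>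
    (\<forall>n. \<forall>u\<in>cx (Uhat n). \<iota> n (Uhat_gamma n u) = transp (L n) gamma_loop (\<iota> n u)) \<and>
    (\<forall>n. \<forall>u\<in>cx (Uhat (Suc n)). q n 1 (\<iota> (Suc n) u) = \<iota> n (fps_cutoff (Suc n) u))"

text \<open>
  An isomorphism of pro-mixed Hodge structures from the fibre at \<open>w\<close> to \<open>\<Prod>\<^sub>j \<rat>(j)\<close> which on
  \<open>Gr\<^sup>W\<close> in weight \<open>-2j\<close> is the given identification: the graded piece of the logarithmic sheaf is
  the constant variation \<open>\<rat>(j)\<close>, with stalk at \<open>1\<close> spanned by \<open>e\<^sup>j\<close>, so its fibre at \<open>w\<close> is
  identified with \<open>\<rat>(j)\<close> by parallel transport along any path from \<open>1\<close> to \<open>w\<close>.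
\<close>

definition canonical_splitting ::
    "(nat \<Rightarrow> 'v::complex_vector variation) \<Rightarrow> (nat \<Rightarrow> complex \<Rightarrow> 'v \<Rightarrow> 'v) \<Rightarrow>
     (nat \<Rightarrow> complex fps \<Rightarrow> 'v) \<Rightarrow> complex \<Rightarrow> (nat \<Rightarrow> 'v \<Rightarrow> nat \<Rightarrow> complex) \<Rightarrow> bool"
  where "canonical_splitting L q \<iota> w \<phi> \<longleftrightarrow>
    (\<forall>n. mhs_iso (fibre (L n) w) (tate_sum n) (\<phi> n)) \<and>
    (\<forall>n. \<forall>x\<in>cx (fibre (L (Suc n)) w). \<phi> n (q n w x) = tate_proj n (\<phi> (Suc n) x)) \<and>
    (\<forall>n j g. Gm_path g \<longrightarrow> pathstart g = 1 \<longrightarrow> pathfinish g = w \<longrightarrow>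
       (\<forall>u\<in>wt (Uhat n) (- 2 * int j). \<phi> n (transp (L n) g (\<iota> n u)) j = fps_nth u j))"

end

theory Submission
  imports Defs "HOL-Complex_Analysis.Complex_Analysis"
begin

text \<open>
  Fix a level \<open>n\<close> and let \<open>U = \<rat>[e]/(e\<^sup>n\<^sup>+\<^sup>1)\<close> be the stalk at \<open>1\<close>. A point \<open>\<zeta>\<close> of the universal cover
  \<open>exp : \<complex> \<rightarrow> \<complex> - {0}\<close> determines the path \<open>t \<mapsto> exp (t\<zeta>)\<close>, and parallel transport along it identifies
  \<open>U \<otimes> \<complex>\<close> with the fibre over \<open>exp \<zeta>\<close>. It respects the rational structure and the weights; what varies
  is the Hodge filtration, pulled back to a filtration \<open>F\<^sub>\<zeta>\<close> of \<open>U \<otimes> \<complex>\<close>. Since \<open>\<gamma>\<close> acts by \<open>exp e\<close>,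
  going once around \<open>0\<close> gives \<open>F\<^sub>\<zeta>\<^sub>+\<^sub>2\<^sub>\<pi>\<^sub>i = exp (-e) F\<^sub>\<zeta>\<close>. The theorem follows from the formula
  \<open>F\<^sub>\<zeta> = exp (-(\<zeta>/2\<pi>i) e) F\<^sub>0\<close> (\<open>mem_period_iff\<close>). A root of unity is \<open>\<omega> = exp (2\<pi>i\<kappa>)\<close> with \<open>\<kappa>\<close>
  rational, so there \<open>F\<^sub>\<zeta>\<close> differs from the split filtration \<open>F\<^sub>0\<close> by \<open>exp (-\<kappa>e)\<close>, which is a
  \<^emph>\<open>rational\<close> automorphism and preserves weights: \<open>exp (\<kappa>e)\<close> composed with inverse transport is the
  splitting (\<open>splitting_iso\<close>). It is the only one because an endomorphism of \<open>\<Oplus> \<rat>(j)\<close> preserves each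
  line \<open>F\<^sup>-\<^sup>j \<inter> W\<^sub>-\<^sub>2\<^sub>j\<close>, and its action there is its action on the graded piece.

  The formula for \<open>F\<^sub>\<zeta>\<close> is a rigidity statement, proved as follows. Because the graded pieces are
  constant, \<open>F\<^sup>0\<^sub>\<zeta>\<close> is a line with a unique generator \<open>v(\<zeta>) = 1 + \<dots>\<close>. It is holomorphic in \<open>\<zeta>\<close>, and
  \<open>exp ((\<zeta>/2\<pi>i) e) v(\<zeta>)\<close> has period \<open>2\<pi>i\<close>; it is the expression of \<open>v\<close> in the frame of the canonical
  extension. Admissibility bounds it near both punctures (\<open>bounded_at_puncture\<close>), so by
  Liouville's theorem it is constant, equal to its value \<open>1\<close> at \<open>\<zeta> = 0\<close> (\<open>untwisted_eq_1\<close>). Hence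
  \<open>v(\<zeta>) = exp (-(\<zeta>/2\<pi>i) e)\<close>. Differentiating multiplies by \<open>e\<close> up to a non-zero scalar, so Griffiths
  transversality puts \<open>e\<^sup>i v(\<zeta>)\<close> into \<open>F\<^sup>-\<^sup>i\<^sub>\<zeta>\<close> (\<open>tower_in_period\<close>), and these vectors already
  fill the filtration, since the constancy of the graded pieces leaves no room for more
  (\<open>period_eq_0\<close>).
\<close>

section \<open>Linear maps on a subspace\<close>

lemma clinear_on_add: "clinear_on S f \<Longrightarrow> x \<in> S \<Longrightarrow> y \<in> S \<Longrightarrow> f (x + y) = f x + f y"
  by (simp add: clinear_on_def)

lemma clinear_on_scale: "clinear_on S f \<Longrightarrow> x \<in> S \<Longrightarrow> f (a *\<^sub>C x) = a *\<^sub>C f x"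
  by (simp add: clinear_on_def)

lemma clinear_on_0:
  assumes "clinear_on S f" "cvec.subspace S"
  shows "f 0 = 0"
  using clinear_on_scale[OF assms(1) cvec.subspace_0[OF assms(2)], of 0] by simp

lemma clinear_on_diff:
  assumes "clinear_on S f" "cvec.subspace S" "x \<in> S" "y \<in> S"
  shows "f (x - y) = f x - f y"
proof -
  have "f (x - y + y) = f (x - y) + f y"
    using assms by (intro clinear_on_add) (auto intro: cvec.subspace_diff)
  thus ?thesis by simp
qed

lemma clinear_on_sum:
  assumes f: "clinear_on S f" and S: "cvec.subspace S" and x: "\<And>k. k \<in> K \<Longrightarrow> x k \<in> S"
  shows "f (\<Sum>k\<in>K. a k *\<^sub>C x k) = (\<Sum>k\<in>K. a k *\<^sub>C f (x k))"
  using x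
proof (induction K rule: infinite_finite_induct)
  case (insert k K)
  have "(\<Sum>k\<in>K. a k *\<^sub>C x k) \<in> S" "a k *\<^sub>C x k \<in> S"
    using S insert.prems by (auto intro!: cvec.subspace_sum cvec.subspace_scale)
  thus ?case
    using insert by (simp add: clinear_on_add[OF f] clinear_on_scale[OF f])
qed (auto simp: clinear_on_0[OF f S])

lemma clinear_on_subset: "clinear_on S f \<Longrightarrow> T \<subseteq> S \<Longrightarrow> clinear_on T f"
  unfolding clinear_on_def by blast

lemma clinear_on_compose:
  "clinear_on S f \<Longrightarrow> f ` S \<subseteq> T \<Longrightarrow> clinear_on T g \<Longrightarrow> clinear_on S (\<lambda>x. g (f x))"
  by (auto simp: clinear_on_def image_subset_iff)

lemma clinear_on_image_subspace:
  assumes f: "clinear_on S f" and T: "cvec.subspace T" "T \<subseteq> S"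
  shows "cvec.subspace (f ` T)"
proof (rule cvec.subspaceI)
  have f': "clinear_on T f" using clinear_on_subset[OF f T(2)] .
  show "0 \<in> f ` T" using clinear_on_0[OF f' T(1)] cvec.subspace_0[OF T(1)] by force
  show "x + y \<in> f ` T" if "x \<in> f ` T" "y \<in> f ` T" for x y
    using that clinear_on_add[OF f'] cvec.subspace_add[OF T(1)] by (auto simp: image_iff) metis
  show "c *\<^sub>C x \<in> f ` T" if "x \<in> f ` T" for x c
    using that clinear_on_scale[OF f'] cvec.subspace_scale[OF T(1)] by (auto simp: image_iff) metis
qed

lemma clinear_on_vimage_subspace:
  assumes f: "clinear_on S f" and S: "cvec.subspace S" and T: "cvec.subspace T"
  shows "cvec.subspace {x \<in> S. f x \<in> T}"
  using cvec.subspace_0[OF S] cvec.subspace_0[OF T] cvec.subspace_add[OF S] cvec.subspace_add[OF T]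
    cvec.subspace_scale[OF S] cvec.subspace_scale[OF T]
  by (intro cvec.subspaceI)
     (auto simp: clinear_on_0[OF f S] clinear_on_add[OF f] clinear_on_scale[OF f])

lemma clinear_on_image_span:
  assumes f: "clinear_on S f" and S: "cvec.subspace S" and B: "B \<subseteq> S"
  shows "f ` cvec.span B = cvec.span (f ` B)"
proof
  have BS: "cvec.span B \<subseteq> S" using B S by (rule cvec.span_minimal)
  show "cvec.span (f ` B) \<subseteq> f ` cvec.span B"
    by (intro cvec.span_minimal clinear_on_image_subspace[OF f cvec.subspace_span BS])
       (auto intro: cvec.span_base)
  have "cvec.span B \<subseteq> {x \<in> S. f x \<in> cvec.span (f ` B)}"
    using B by (intro cvec.span_minimal clinear_on_vimage_subspace[OF f S])
      (auto intro: cvec.span_base)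
  thus "f ` cvec.span B \<subseteq> cvec.span (f ` B)" by auto
qed

lemma subspace_cx [simp]: "cvec.subspace (cx M)"
  by (simp add: cx_def)

lemma subspace_wtC [simp]: "cvec.subspace (wtC M k)"
  by (simp add: wtC_def)

text \<open>
  The right-hand side is the shape of \<open>gr_hdg\<close>; the point is that an injective linear map also
  commutes with the intersection.
\<close>

lemma gr_hdg_image:
  assumes f: "clinear_on S f" and inj: "inj_on f S"
    and sub: "H \<subseteq> S" "W \<subseteq> S" "W' \<subseteq> S"
  shows "f ` ((H \<inter> W) + W') = (f ` H \<inter> f ` W) + f ` W'"
proof -
  have "f ` (A + W') = f ` A + f ` W'" if "A \<subseteq> S" for A
  proof -
    have add: "f (a + b) = f a + f b" if "a \<in> A" "b \<in> W'" for a b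
      using that \<open>A \<subseteq> S\<close> sub by (intro clinear_on_add[OF f]) auto
    show ?thesis
    proof (intro equalityI subsetI)
      fix x assume "x \<in> f ` (A + W')"
      thus "x \<in> f ` A + f ` W'" using add by (auto elim!: set_plus_elim intro!: set_plus_intro)
    next
      fix x assume "x \<in> f ` A + f ` W'"
      then obtain a b where "x = f a + f b" "a \<in> A" "b \<in> W'" by (auto elim!: set_plus_elim)
      thus "x \<in> f ` (A + W')" using add by (metis image_eqI set_plus_intro)
    qed
  qed
  moreover have "f ` (H \<inter> W) = f ` H \<inter> f ` W"
    using inj sub by (intro inj_on_image_Int) auto
  ultimately show ?thesis using sub by (metis Int_lower1 order_trans)
qed

section \<open>Isomorphisms of mixed Hodge structures\<close>

lemma mhs_hom_cx:
  assumes "mhs_hom M N f"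
  shows "f ` cx M \<subseteq> cx N"
proof -
  have "f ` cx M = cvec.span (f ` lattice M)"
    unfolding cx_def using assms
    by (intro clinear_on_image_span[where S = "cx M"])
       (auto simp: mhs_hom_def cx_def intro: cvec.span_base)
  also have "\<dots> \<subseteq> cx N"
    unfolding cx_def using assms by (intro cvec.span_mono) (auto simp: mhs_hom_def)
  finally show ?thesis .
qed

text \<open>
  A two-sided inverse is only required on the ambient space, so an isomorphism maps each step of
  the filtrations onto the corresponding step only when these steps lie in the ambient space.
\<close>

definition filtrations_inside :: "'v::complex_vector mhs \<Rightarrow> bool"
  where "filtrations_inside M \<longleftrightarrow> (\<forall>k. wt M k \<subseteq> lattice M) \<and> (\<forall>p. hdg M p \<subseteq> cx M)"

lemma filtrations_inside_mhs: "mixed_hodge_structure M \<Longrightarrow> filtrations_inside M"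
  by (simp add: mixed_hodge_structure_def filtrations_inside_def rat_filtration_def)

lemma mhs_isoD:
  assumes iso: "mhs_iso M N f" and M: "filtrations_inside M" and N: "filtrations_inside N"
  shows "clinear_on (cx M) f" "bij_betw f (cx M) (cx N)" "f ` lattice M = lattice N"
    "f ` wt M k = wt N k" "f ` hdg M p = hdg N p"
proof -
  obtain g where f: "mhs_hom M N f" and g: "mhs_hom N M g"
    and gf: "\<And>x. x \<in> cx M \<Longrightarrow> g (f x) = x" and fg: "\<And>y. y \<in> cx N \<Longrightarrow> f (g y) = y"
    using iso by (auto simp: mhs_iso_def)
  show "clinear_on (cx M) f" using f by (simp add: mhs_hom_def)
  show "bij_betw f (cx M) (cx N)"
    using mhs_hom_cx[OF f] mhs_hom_cx[OF g] gf fg by (intro bij_betw_byWitness[where f' = g]) auto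
  have onto: "f ` S = T" if "f ` S \<subseteq> T" "g ` T \<subseteq> S" "T \<subseteq> cx N" for S T
  proof
    show "T \<subseteq> f ` S"
    proof
      fix y assume "y \<in> T"
      hence "y = f (g y)" "g y \<in> S" using that fg[of y] by auto
      thus "y \<in> f ` S" by blast
    qed
  qed (use that in auto)
  have latcx: "lattice N \<subseteq> cx N" by (auto simp: cx_def intro: cvec.span_base)
  show "f ` lattice M = lattice N"
    using f g latcx by (intro onto) (auto simp: mhs_hom_def)
  show "f ` wt M k = wt N k"
    using f g latcx N by (intro onto) (auto simp: mhs_hom_def filtrations_inside_def)
  show "f ` hdg M p = hdg N p"
    using f g N by (intro onto) (auto simp: mhs_hom_def filtrations_inside_def)
qed

lemma mhs_isoI:
  assumes f: "clinear_on (cx M) f" and bij: "bij_betw f (cx M) (cx N)"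
    and lat: "f ` lattice M = lattice N" and wt: "\<And>k. f ` wt M k = wt N k"
    and hdg: "\<And>p. f ` hdg M p = hdg N p" and M: "filtrations_inside M"
  shows "mhs_iso M N f"
proof -
  define g where "g = inv_into (cx M) f"
  have inj: "inj_on f (cx M)" using bij by (simp add: bij_betw_def)
  have gf: "g (f x) = x" if "x \<in> cx M" for x using inj that by (simp add: g_def)
  have img: "f ` cx M = cx N" using bij by (simp add: bij_betw_def)
  have fg: "f (g y) = y" if "y \<in> cx N" for y using that img by (simp add: g_def f_inv_into_f)
  have g_image: "g ` (f ` S) = S" if "S \<subseteq> cx M" for S
    using that gf by (force simp: image_iff)
  have latcx: "lattice M \<subseteq> cx M" by (auto simp: cx_def intro: cvec.span_base)
  have gimg: "g y \<in> cx M" if "y \<in> cx N" for y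
    using g_image[of "cx M"] img that by auto
  have "g (x + y) = g x + g y" if "x \<in> cx N" "y \<in> cx N" for x y
  proof -
    have "x + y = f (g x + g y)"
      using that by (simp add: clinear_on_add[OF f] gimg fg)
    thus ?thesis using that gimg by (simp add: gf cvec.subspace_add[OF subspace_cx])
  qed
  moreover have "g (a *\<^sub>C x) = a *\<^sub>C g x" if "x \<in> cx N" for x a
  proof -
    have "a *\<^sub>C x = f (a *\<^sub>C g x)"
      using that by (simp add: clinear_on_scale[OF f] gimg fg)
    thus ?thesis using that gimg by (simp add: gf cvec.subspace_scale[OF subspace_cx])
  qed
  ultimately have "clinear_on (cx N) g" by (simp add: clinear_on_def)
  moreover have "g ` lattice N = lattice M" using g_image[OF latcx] lat by simp
  moreover have "g ` wt N k = wt M k" for k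
  proof -
    have "wt M k \<subseteq> cx M" using M latcx unfolding filtrations_inside_def by blast
    thus ?thesis using g_image[of "wt M k"] wt[of k] by simp
  qed
  moreover have "g ` hdg N p = hdg M p" for p
    using g_image[of "hdg M p"] hdg[of p] M by (simp add: filtrations_inside_def)
  ultimately have "mhs_hom N M g" by (simp add: mhs_hom_def)
  moreover have "mhs_hom M N f" using f lat wt hdg by (simp add: mhs_hom_def)
  ultimately show ?thesis using gf fg by (auto simp: mhs_iso_def)
qed

section \<open>The truncations of the completed group ring\<close>

lemma fps_nth_scaleC [simp]: "fps_nth (a *\<^sub>C f) j = a * fps_nth (f :: complex fps) j"
  by (simp add: scaleC_fps_def scaleC_complex_def)

lemma scaleC_fps_eq: "a *\<^sub>C (f :: complex fps) = fps_const a * f"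
  by (simp add: fps_eq_iff)

lemma lattice_tate_sum: "lattice (tate_sum n) = {f. (\<forall>i\<le>n. f i \<in> \<rat>) \<and> (\<forall>i>n. f i = 0)}"
  by (auto simp: tate_sum_def mhs_sum_def family_sum_def tate_def)

lemma wt_tate_sum: "wt (tate_sum n) k =
    {f. (\<forall>i\<le>n. f i \<in> \<rat> \<and> (k < - 2 * int i \<longrightarrow> f i = 0)) \<and> (\<forall>i>n. f i = 0)}"
proof -
  have "f \<in> wt (tate_sum n) k \<longleftrightarrow>
      (\<forall>i\<in>{..n}. f i \<in> (if - 2 * int i \<le> k then \<rat> else {0})) \<and> (\<forall>i. i \<notin> {..n} \<longrightarrow> f i = 0)" for f
    by (simp only: tate_sum_def mhs_sum_def family_sum_def tate_def mhs.simps mem_Collect_eq)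
  moreover have "(x \<in> (if - 2 * int i \<le> k then \<rat> else {0})) \<longleftrightarrow>
      x \<in> \<rat> \<and> (k < - 2 * int i \<longrightarrow> x = 0)" for x :: complex and i
    by auto
  ultimately show ?thesis
    by (intro set_eqI) (simp only: mem_Collect_eq atMost_iff not_le Ball_def)
qed

lemma hdg_tate_sum: "hdg (tate_sum n) p =
    {f. \<forall>i. f i \<noteq> 0 \<longrightarrow> i \<le> n \<and> p \<le> - int i}"
proof -
  have "f \<in> hdg (tate_sum n) p \<longleftrightarrow>
      (\<forall>i\<in>{..n}. f i \<in> (if p \<le> - int i then UNIV else {0})) \<and> (\<forall>i. i \<notin> {..n} \<longrightarrow> f i = 0)" for f
    by (simp only: tate_sum_def mhs_sum_def family_sum_def tate_def mhs.simps mem_Collect_eq)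
  moreover have "(x \<in> (if P then UNIV else {0})) \<longleftrightarrow> P \<or> x = 0" for x :: complex and P
    by simp
  ultimately have "f \<in> hdg (tate_sum n) p \<longleftrightarrow> (\<forall>i. f i \<noteq> 0 \<longrightarrow> i \<le> n \<and> p \<le> - int i)" for f
    by (simp only: atMost_iff) blast
  thus ?thesis by (intro set_eqI) (simp only: mem_Collect_eq)
qed

lemma mem_image_Abs_fps: "u \<in> Abs_fps ` S \<longleftrightarrow> fps_nth u \<in> S"
proof
  assume "fps_nth u \<in> S"
  moreover have "u = Abs_fps (fps_nth u)" by (simp add: fps_eq_iff)
  ultimately show "u \<in> Abs_fps ` S" by blast
next
  assume "u \<in> Abs_fps ` S"
  then obtain f where "f \<in> S" "u = Abs_fps f" by blast
  moreover have "fps_nth (Abs_fps f) = f" by (simp add: fun_eq_iff)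
  ultimately show "fps_nth u \<in> S" by simp
qed

lemma lattice_Uhat: "lattice (Uhat n) =
    {u. (\<forall>i\<le>n. fps_nth u i \<in> \<rat>) \<and> (\<forall>i>n. fps_nth u i = 0)}"
  by (auto simp: Uhat_def mem_image_Abs_fps lattice_tate_sum)

lemma wt_Uhat: "wt (Uhat n) k =
    {u. (\<forall>i\<le>n. fps_nth u i \<in> \<rat> \<and> (k < - 2 * int i \<longrightarrow> fps_nth u i = 0)) \<and>
      (\<forall>i>n. fps_nth u i = 0)}"
  by (auto simp: Uhat_def mem_image_Abs_fps wt_tate_sum)

lemma hdg_Uhat: "hdg (Uhat n) p = {u. \<forall>i. fps_nth u i \<noteq> 0 \<longrightarrow> i \<le> n \<and> p \<le> - int i}"
  by (auto simp: Uhat_def mem_image_Abs_fps hdg_tate_sum)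

lemma truncated_fps_sum:
  fixes u :: "complex fps"
  assumes "\<And>i. i > n \<Longrightarrow> fps_nth u i = 0"
  shows "u = (\<Sum>i\<le>n. fps_nth u i *\<^sub>C fps_X ^ i)"
proof (rule fps_ext)
  fix j
  have "fps_nth (\<Sum>i\<le>n. fps_nth u i *\<^sub>C fps_X ^ i) j = (\<Sum>i\<le>n. if i = j then fps_nth u j else 0)"
    unfolding fps_sum_nth by (rule sum.cong) (auto simp: fps_X_power_nth)
  thus "fps_nth u j = fps_nth (\<Sum>i\<le>n. fps_nth u i *\<^sub>C fps_X ^ i) j"
    using assms[of j] by auto
qed

lemma wtC_Uhat: "wtC (Uhat n) k = {u. \<forall>i. fps_nth u i \<noteq> 0 \<longrightarrow> i \<le> n \<and> - 2 * int i \<le> k}"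
  (is "_ = ?S")
proof
  have "cvec.subspace ?S"
    by (rule cvec.subspaceI) (auto, (metis add.right_neutral)+)
  thus "wtC (Uhat n) k \<subseteq> ?S"
    unfolding wtC_def by (intro cvec.span_minimal) (auto simp: wt_Uhat not_less[symmetric])
  show "?S \<subseteq> wtC (Uhat n) k"
  proof
    fix u assume u: "u \<in> ?S"
    have "fps_nth u i *\<^sub>C fps_X ^ i \<in> wtC (Uhat n) k" if "i \<le> n" for i
    proof (cases "fps_nth u i = 0")
      case False
      hence "- 2 * int i \<le> k" using u by auto
      hence "fps_X ^ i \<in> wt (Uhat n) k"
        using that by (auto simp: wt_Uhat fps_X_power_nth)
      thus ?thesis
        unfolding wtC_def by (intro cvec.span_scale cvec.span_base)
    qed (simp add: cvec.subspace_0)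
    hence "(\<Sum>i\<le>n. fps_nth u i *\<^sub>C fps_X ^ i) \<in> wtC (Uhat n) k"
      by (intro cvec.subspace_sum) auto
    thus "u \<in> wtC (Uhat n) k"
      using truncated_fps_sum[of n u] u by (metis (mono_tags, lifting) mem_Collect_eq not_le)
  qed
qed

lemma lattice_Uhat_wt: "lattice (Uhat n) = wt (Uhat n) 0"
  by (auto simp: lattice_Uhat wt_Uhat)

lemma cx_Uhat: "cx (Uhat n) = {u. \<forall>i>n. fps_nth u i = 0}"
proof -
  have "cx (Uhat n) = wtC (Uhat n) 0" by (simp add: cx_def wtC_def lattice_Uhat_wt)
  thus ?thesis by (auto simp: wtC_Uhat not_le[symmetric])
qed

lemma filtrations_inside_Uhat: "filtrations_inside (Uhat n)"
  by (auto simp: filtrations_inside_def wt_Uhat lattice_Uhat hdg_Uhat cx_Uhat not_less[symmetric])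

lemma fps_nth_image_Abs_fps: "fps_nth ` Abs_fps ` S = S"
  by (simp add: image_image Abs_fps_inverse)

lemma cx_tate_sum: "fps_nth ` cx (Uhat n) = cx (tate_sum n)"
proof -
  have lin: "clinear_on UNIV (fps_nth :: complex fps \<Rightarrow> _)"
    by (auto simp: clinear_on_def fun_eq_iff scaleC_fun_def scaleC_complex_def plus_fun_def)
  have "fps_nth ` lattice (Uhat n) = lattice (tate_sum n)"
    by (simp add: Uhat_def fps_nth_image_Abs_fps)
  thus ?thesis
    unfolding cx_def using clinear_on_image_span[OF lin, of "lattice (Uhat n)"] by simp
qed

lemma hdg_Uhat_subset: "hdg (Uhat n) p \<subseteq> cx (Uhat n)"
  using filtrations_inside_Uhat by (simp add: filtrations_inside_def)

lemma wt_Uhat_subset: "wt (Uhat n) k \<subseteq> cx (Uhat n)"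
  by (auto simp: wt_Uhat cx_Uhat)

lemma wtC_Uhat_subset: "wtC (Uhat n) k \<subseteq> cx (Uhat n)"
  by (auto simp: wtC_Uhat cx_Uhat not_le[symmetric])

lemma cx_Uhat_expand: "u \<in> cx (Uhat n) \<Longrightarrow> (\<Sum>j\<le>n. fps_nth u j *\<^sub>C fps_X ^ j) = u"
  using truncated_fps_sum[of n u] by (simp add: cx_Uhat)

lemma cutoff_in_cx [simp]: "fps_cutoff (Suc n) f \<in> cx (Uhat n)"
  by (simp add: cx_Uhat)

lemma cutoff_cx: "u \<in> cx (Uhat n) \<Longrightarrow> fps_cutoff (Suc n) u = u"
  by (auto simp: cx_Uhat fps_eq_iff)

lemma cutoff_mult_cutoff:
  "fps_cutoff (Suc n) (f * fps_cutoff (Suc n) g) = fps_cutoff (Suc n) (f * (g :: complex fps))"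
  by (auto simp: fps_eq_iff fps_cutoff_right_mult_nth)

lemma cutoff_cutoff_mult:
  "fps_cutoff (Suc n) (fps_cutoff (Suc n) f * g) = fps_cutoff (Suc n) (f * (g :: complex fps))"
  by (auto simp: fps_eq_iff fps_cutoff_left_mult_nth)

section \<open>Multiplication by exponentials\<close>

definition expmul :: "nat \<Rightarrow> complex \<Rightarrow> complex fps \<Rightarrow> complex fps"
  where "expmul n c u = fps_cutoff (Suc n) (fps_exp c * u)"

lemma Uhat_gamma_eq: "Uhat_gamma n = expmul n 1"
  by (simp add: Uhat_gamma_def expmul_def fun_eq_iff)

lemma expmul_in_cx [simp]: "expmul n c u \<in> cx (Uhat n)"
  by (simp add: expmul_def)

lemma expmul_add: "expmul n c (expmul n d u) = expmul n (c + d) u"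
  by (simp add: expmul_def cutoff_mult_cutoff fps_exp_add_mult mult.assoc)

lemma expmul_0: "u \<in> cx (Uhat n) \<Longrightarrow> expmul n 0 u = u"
  by (simp add: expmul_def cutoff_cx)

lemma expmul_cancel: "u \<in> cx (Uhat n) \<Longrightarrow> c + d = 0 \<Longrightarrow> expmul n c (expmul n d u) = u"
  by (simp add: expmul_add expmul_0)

lemma clinear_expmul: "clinear_on S (expmul n c)"
proof -
  have "fps_exp c * (fps_const a * x) = fps_const a * (fps_exp c * x)" for a and x :: "complex fps"
    by (simp add: mult.left_commute)
  thus ?thesis
    unfolding clinear_on_def expmul_def scaleC_fps_eq fps_cutoff_add distrib_left
    by (auto simp: fps_eq_iff)
qed

lemma nth_expmul:
  "fps_nth (expmul n c u) j = (if j \<le> n then \<Sum>i=0..j. c ^ i / fact i * fps_nth u (j - i) else 0)"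
  by (simp add: expmul_def fps_mult_nth fps_exp_def)

lemma nth_expmul_power:
  "fps_nth (expmul n c (fps_X ^ i)) j = (if i \<le> j \<and> j \<le> n then c ^ (j - i) / fact (j - i) else 0)"
  by (simp add: expmul_def fps_X_power_mult_right_nth fps_exp_def)

lemma nth_expmul_0 [simp]: "fps_nth (expmul n c u) 0 = fps_nth u 0"
  by (simp add: nth_expmul)

lemma nth_expmul_leading:
  assumes "\<And>i. i < j \<Longrightarrow> fps_nth u i = 0" "j \<le> n"
  shows "fps_nth (expmul n c u) j = fps_nth u j"
proof -
  have "(\<Sum>i=0..j. c ^ i / fact i * fps_nth u (j - i)) = (\<Sum>i\<in>{0}. c ^ i / fact i * fps_nth u (j - i))"
    using assms(1) by (intro sum.mono_neutral_right) auto
  thus ?thesis using assms(2) by (simp add: nth_expmul)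
qed

lemma expmul_wtC: 
  assumes "u \<in> wtC (Uhat n) k"
  shows "expmul n c u \<in> wtC (Uhat n) k"
proof -
  have "- 2 * int j \<le> k" if "fps_nth (expmul n c u) j \<noteq> 0" "j \<le> n" for j
  proof -
    have "(\<Sum>i=0..j. c ^ i / fact i * fps_nth u (j - i)) \<noteq> 0"
      using that by (simp add: nth_expmul)
    then obtain i where "i \<in> {0..j}" "c ^ i / fact i * fps_nth u (j - i) \<noteq> 0"
      by (rule sum.not_neutral_contains_not_neutral)
    hence "i \<le> j" "fps_nth u (j - i) \<noteq> 0" by auto
    thus ?thesis using assms by (fastforce simp: wtC_Uhat)
  qed
  thus ?thesis using cutoff_in_cx by (auto simp: wtC_Uhat nth_expmul split: if_splits)
qed

lemma expmul_image:
  assumes "\<And>u. u \<in> S \<Longrightarrow> expmul n c u \<in> S'" "\<And>u. u \<in> S' \<Longrightarrow> expmul n (- c) u \<in> S"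
    and "S' \<subseteq> cx (Uhat n)"
  shows "expmul n c ` S = S'"
proof
  show "S' \<subseteq> expmul n c ` S"
  proof
    fix u assume u: "u \<in> S'"
    hence "u = expmul n c (expmul n (- c) u)" using assms(3) by (subst expmul_cancel) auto
    thus "u \<in> expmul n c ` S" using assms(2)[OF u] by blast
  qed
qed (use assms(1) in blast)

lemma wt_Uhat_eq: "wt (Uhat n) k = lattice (Uhat n) \<inter> wtC (Uhat n) k"
  by (auto simp: wt_Uhat wtC_Uhat lattice_Uhat not_le[symmetric])

lemma expmul_lattice:
  assumes "c \<in> \<rat>" "u \<in> lattice (Uhat n)"
  shows "expmul n c u \<in> lattice (Uhat n)"
proof -
  have "fact i \<in> (\<rat> :: complex set)" for i
    by (metis Rats_of_nat of_nat_fact)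
  thus ?thesis
    using assms by (auto simp: lattice_Uhat nth_expmul intro!: Rats_sum Rats_mult Rats_divide Rats_power)
qed
  
lemma expmul_wt: "c \<in> \<rat> \<Longrightarrow> u \<in> wt (Uhat n) k \<Longrightarrow> expmul n c u \<in> wt (Uhat n) k"
  by (simp add: wt_Uhat_eq expmul_lattice expmul_wtC)

section \<open>Functional calculus for nilpotent operators\<close>

lemma nilpotent_power:
  assumes M: "\<And>u. u \<in> cx (Uhat n) \<Longrightarrow> M (\<iota> u) = \<iota> (fps_cutoff (Suc n) (D * u))"
    and u: "u \<in> cx (Uhat n)"
  shows "(M ^^ k) (\<iota> u) = \<iota> (fps_cutoff (Suc n) (D ^ k * u))"
  by (induction k) (simp_all add: u cutoff_cx M cutoff_mult_cutoff mult.assoc)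

text \<open>
  The sums that define logarithm and exponential of an operator range over the powers that do not
  kill the given vector. For multiplication by a series \<open>D\<close> without constant term they are
  composition of power series, truncated.
\<close>

lemma nilpotent_series:
  fixes f D :: "complex fps"
  assumes \<iota>: "clinear_on (cx (Uhat n)) \<iota>"
    and M: "\<And>u. u \<in> cx (Uhat n) \<Longrightarrow> M (\<iota> u) = \<iota> (fps_cutoff (Suc n) (D * u))"
    and D: "fps_nth D 0 = 0" and u: "u \<in> cx (Uhat n)"
    and f: "\<And>k. \<not> P k \<Longrightarrow> fps_nth f k = 0"
  shows "(\<Sum>k | P k \<and> (M ^^ k) (\<iota> u) \<noteq> 0. fps_nth f k *\<^sub>C (M ^^ k) (\<iota> u)) =
    \<iota> (fps_cutoff (Suc n) ((f oo D) * u))"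
proof -
  have 0: "\<iota> 0 = 0" by (rule clinear_on_0[OF \<iota>]) simp
  have zero: "(M ^^ k) (\<iota> u) = 0" if "k > n" for k
  proof -
    have "fps_cutoff (Suc n) (D ^ k) = 0"
      using startsby_zero_power_prefix[OF D, of k] that by (auto simp: fps_eq_iff)
    hence "fps_cutoff (Suc n) (D ^ k * u) = 0"
      by (subst cutoff_cutoff_mult[symmetric]) simp
    thus ?thesis by (simp add: nilpotent_power[where \<iota> = \<iota> and M = M and D = D, OF M u] 0)
  qed
  have "(\<Sum>k | P k \<and> (M ^^ k) (\<iota> u) \<noteq> 0. fps_nth f k *\<^sub>C (M ^^ k) (\<iota> u)) =
      (\<Sum>k\<le>n. fps_nth f k *\<^sub>C (M ^^ k) (\<iota> u))"
    using zero f by (intro sum.mono_neutral_left) (auto simp: not_less[symmetric])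
  also have "\<dots> = \<iota> (\<Sum>k\<le>n. fps_nth f k *\<^sub>C fps_cutoff (Suc n) (D ^ k * u))"
    by (simp add: nilpotent_power[where \<iota> = \<iota> and M = M and D = D, OF M u] clinear_on_sum[OF \<iota>])
  also have "(\<Sum>k\<le>n. fps_nth f k *\<^sub>C fps_cutoff (Suc n) (D ^ k * u)) =
      fps_cutoff (Suc n) ((\<Sum>k\<le>n. fps_const (fps_nth f k) * D ^ k) * u)"
    by (auto simp: fps_eq_iff fps_sum_nth sum_distrib_right mult.assoc)
  also have "\<dots> = fps_cutoff (Suc n) ((f oo D) * u)"
  proof -
    have "fps_nth (\<Sum>k\<le>n. fps_const (fps_nth f k) * D ^ k) i = fps_nth (f oo D) i" if "i \<le> n" for i
    proof -
      have "(\<Sum>k\<in>{0..i}. fps_nth f k * fps_nth (D ^ k) i) = (\<Sum>k\<le>n. fps_nth f k * fps_nth (D ^ k) i)"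
        using that startsby_zero_power_prefix[OF D] by (intro sum.mono_neutral_left) auto
      thus ?thesis by (simp only: fps_sum_nth fps_compose_nth fps_mult_left_const_nth)
    qed
    hence "fps_cutoff (Suc n) (\<Sum>k\<le>n. fps_const (fps_nth f k) * D ^ k) = fps_cutoff (Suc n) (f oo D)"
      by (auto simp: fps_eq_iff)
    thus ?thesis by (metis cutoff_cutoff_mult)
  qed
  finally show ?thesis .
qed

lemma fps_ln_compose_exp:
  fixes c :: complex assumes "c \<noteq> 0"
  shows "fps_ln 1 oo (fps_exp c - 1) = fps_const c * fps_X"
proof -
  let ?D = "fps_exp c - 1 :: complex fps"
  have D: "fps_nth ?D 0 = 0" "fps_nth ?D 1 \<noteq> 0" using assms by simp_all
  have "fps_ln 1 = fps_const c * fps_ln c"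
    using assms by (simp add: fps_eq_iff fps_ln_def)
  hence "fps_ln 1 oo ?D = fps_const c * (fps_ln c oo ?D)"
    by (simp only: fps_const_mult_apply_left)
  also have "fps_ln c oo ?D = fps_X"
    using fps_inv[OF D] fps_ln_fps_exp_inv[OF assms] by simp
  finally show ?thesis .
qed

lemma ulog_expmul:
  fixes \<iota> :: "complex fps \<Rightarrow> 'v::complex_vector"
  assumes \<iota>: "clinear_on (cx (Uhat n)) \<iota>" and c: "c \<noteq> 0" and u: "u \<in> cx (Uhat n)"
    and T: "\<And>u. u \<in> cx (Uhat n) \<Longrightarrow> T (\<iota> u) = \<iota> (expmul n c u)"
  shows "ulog T (\<iota> u) = \<iota> (fps_cutoff (Suc n) (fps_const c * fps_X * u))"
proof -
  have M: "T (\<iota> u) - \<iota> u = \<iota> (fps_cutoff (Suc n) ((fps_exp c - 1) * u))" if "u \<in> cx (Uhat n)" for u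
  proof -
    have "T (\<iota> u) - \<iota> u = \<iota> (expmul n c u - u)"
      using that by (simp add: T clinear_on_diff[OF \<iota>])
    also have "expmul n c u - u = fps_cutoff (Suc n) ((fps_exp c - 1) * u)"
      using cutoff_cx[OF that] by (simp add: expmul_def fps_cutoff_diff algebra_simps)
    finally show ?thesis .
  qed
  have ln: "(- 1) ^ (k + 1) / of_nat k = fps_nth (fps_ln 1) k" if "0 < k" for k :: nat
    using that by (cases k) (auto simp: fps_ln_def)
  have "ulog T (\<iota> u) = (\<Sum>k | 0 < k \<and> ((\<lambda>x. T x - x) ^^ k) (\<iota> u) \<noteq> 0.
           fps_nth (fps_ln 1) k *\<^sub>C ((\<lambda>x. T x - x) ^^ k) (\<iota> u))"
    unfolding ulog_def by (intro sum.cong refl) (simp only: ln mem_Collect_eq)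
  also have "\<dots> = \<iota> (fps_cutoff (Suc n) ((fps_ln 1 oo (fps_exp c - 1)) * u))"
    using M u by (intro nilpotent_series[OF \<iota>]) (auto simp: fps_ln_def)
  finally show ?thesis by (simp add: fps_ln_compose_exp[OF c])
qed

lemma nexp_X:
  fixes \<iota> :: "complex fps \<Rightarrow> 'v::complex_vector"
  assumes \<iota>: "clinear_on (cx (Uhat n)) \<iota>" and u: "u \<in> cx (Uhat n)"
    and N: "\<And>u. u \<in> cx (Uhat n) \<Longrightarrow> N (\<iota> u) = \<iota> (fps_cutoff (Suc n) (fps_const c * fps_X * u))"
  shows "nexp (\<lambda>x. d *\<^sub>C N x) (\<iota> u) = \<iota> (expmul n (c * d) u)"
proof -
  let ?D = "fps_const (c * d) * fps_X :: complex fps"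
  have M: "d *\<^sub>C N (\<iota> u) = \<iota> (fps_cutoff (Suc n) (?D * u))" if "u \<in> cx (Uhat n)" for u
  proof -
    have "d *\<^sub>C N (\<iota> u) = \<iota> (d *\<^sub>C fps_cutoff (Suc n) (fps_const c * fps_X * u))"
      using that by (simp add: N clinear_on_scale[OF \<iota>])
    also have "d *\<^sub>C fps_cutoff (Suc n) (fps_const c * fps_X * u) = fps_cutoff (Suc n) (?D * u)"
      by (auto simp: fps_eq_iff mult.assoc)
    finally show ?thesis .
  qed
  have "nexp (\<lambda>x. d *\<^sub>C N x) (\<iota> u) = (\<Sum>k | True \<and> ((\<lambda>x. d *\<^sub>C N x) ^^ k) (\<iota> u) \<noteq> 0.
      fps_nth (fps_exp 1) k *\<^sub>C ((\<lambda>x. d *\<^sub>C N x) ^^ k) (\<iota> u))"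
    unfolding nexp_def by (simp add: fps_exp_def)
  also have "\<dots> = \<iota> (fps_cutoff (Suc n) ((fps_exp 1 oo ?D) * u))"
    using M u by (intro nilpotent_series[OF \<iota>]) auto
  finally show ?thesis by (simp add: expmul_def)
qed

section \<open>Exponential paths\<close>

definition logpath :: "complex \<Rightarrow> real \<Rightarrow> complex"
  where "logpath \<zeta> = (\<lambda>t. exp (of_real t * \<zeta>))"

lemma logpath_eq: "logpath \<zeta> = exp \<circ> linepath 0 \<zeta>"
  by (simp add: logpath_def linepath_def fun_eq_iff scaleR_conv_of_real)

lemma gamma_loop_eq: "gamma_loop = logpath (2 * of_real pi * \<i>)"
  by (simp add: logpath_def gamma_loop_def fun_eq_iff mult_ac)

lemma Gm_path_exp: "path h \<Longrightarrow> Gm_path (exp \<circ> h)"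
  by (auto simp: Gm_path_def path_image_def intro!: path_continuous_image continuous_intros)

lemma Gm_path_logpath [simp]: "Gm_path (logpath \<zeta>)"
  by (simp add: logpath_eq Gm_path_exp)

lemma pathstart_logpath [simp]: "pathstart (logpath \<zeta>) = 1"
  by (simp add: logpath_def pathstart_def)

lemma pathfinish_logpath [simp]: "pathfinish (logpath \<zeta>) = exp \<zeta>"
  by (simp add: logpath_def pathfinish_def)

text \<open>
  The plane is convex, so a path upstairs can be straightened, and \<open>exp\<close> carries the homotopy down.
  Giving lifts explicitly replaces the lifting theorem for coverings.
\<close>

lemma homotopic_exp_logpath:
  assumes "path h" "pathstart h = 0" "pathfinish h = \<zeta>"
  shows "homotopic_paths (- {0}) (exp \<circ> h) (logpath \<zeta>)"
proof -
  have "homotopic_paths UNIV h (linepath 0 \<zeta>)"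
    using assms by (intro homotopic_paths_linear) auto
  thus ?thesis
    unfolding logpath_eq
    by (rule homotopic_paths_continuous_image) (auto intro: continuous_intros)
qed

lemma ball_1_slit: "w \<in> ball 1 1 \<Longrightarrow> w \<notin> \<real>\<^sub>\<le>\<^sub>0" for w :: complex
  using complex_Re_le_cmod[of "1 - w"] by (auto simp: dist_norm complex_nonpos_Reals_iff)

lemma divide_in_ball_1:
  fixes a z :: complex
  assumes "0 \<notin> ball a r" "z \<in> ball a r"
  shows "z / a \<in> ball 1 1"
proof -
  have "a \<noteq> 0" using assms le_less_trans[OF zero_le_dist[of a z], of r] by auto
  have "norm (a - z) < norm a" using assms by (simp add: dist_norm)
  hence "norm (a - z) / norm a < 1" using \<open>a \<noteq> 0\<close> by simp
  moreover have "1 - z / a = (a - z) / a" using \<open>a \<noteq> 0\<close> by (simp add: diff_divide_distrib)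
  ultimately show ?thesis by (simp add: dist_norm norm_divide)
qed

text \<open>
  This is the only place where the hypothesis on \<open>\<omega>\<close> enters: its logarithm is a rational multiple
  of \<open>2\<pi>i\<close>.
\<close>

lemma root_of_unity_exp:
  assumes "m > 0" "\<omega> ^ m = (1 :: complex)"
  obtains \<kappa> where "\<kappa> \<in> \<rat>" "exp (\<kappa> * (2 * of_real pi * \<i>)) = \<omega>"
proof -
  have "\<omega> \<noteq> 0" using assms by (auto simp: power_0_left)
  hence "exp (of_nat m * Ln \<omega>) = 1" using assms(2) by (simp add: exp_of_nat_mult)
  then obtain k :: int where "Re (of_nat m * Ln \<omega>) = 0" "Im (of_nat m * Ln \<omega>) = of_int (2 * k) * pi"
    by (auto simp: exp_eq_1)
  hence "of_nat m * Ln \<omega> = of_int k * (2 * of_real pi * \<i>)" by (simp add: complex_eq_iff)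
  hence "(of_int k / of_nat m) * (2 * of_real pi * \<i>) = Ln \<omega>" using assms(1) by (simp add: field_simps)
  hence "exp ((of_int k / of_nat m) * (2 * of_real pi * \<i>)) = \<omega>"
    using \<open>\<omega> \<noteq> 0\<close> by (metis exp_Ln)
  moreover have "of_int k / of_nat m \<in> (\<rat> :: complex set)" by simp
  ultimately show ?thesis using that by blast
qed

section \<open>Holomorphic line subbundles\<close>

text \<open>
  Frames of a holomorphic subbundle are combinations of arbitrary vectors of the big space, which
  need not lie in the fibre; coordinates on the fibre therefore have to be extended linearly to the
  whole space before they can be applied to the individual terms.
\<close>

lemma coordinates_exist:
  fixes T :: "complex fps \<Rightarrow> 'v::complex_vector"
  assumes T: "clinear_on (cx (Uhat n)) T" and inj: "inj_on T (cx (Uhat n))"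
  shows "\<exists>C. clinear_on UNIV C \<and> (\<forall>u\<in>cx (Uhat n). C (T u) = u)"
proof -
  interpret vector_space_pair "scaleC :: complex \<Rightarrow> complex fps \<Rightarrow> _" "scaleC :: complex \<Rightarrow> 'v \<Rightarrow> _"
    by unfold_locales
  let ?T = "\<lambda>u. T (fps_cutoff (Suc n) u)"
  have "?T (a *\<^sub>C u) = a *\<^sub>C ?T u" for a u
  proof -
    have "fps_cutoff (Suc n) (a *\<^sub>C u) = a *\<^sub>C fps_cutoff (Suc n) u" by (auto simp: fps_eq_iff)
    thus ?thesis by (simp add: clinear_on_scale[OF T])
  qed
  hence "Vector_Spaces.linear scaleC scaleC ?T"
    unfolding Vector_Spaces.linear_iff
    by (auto simp: cvec.vector_space_axioms fps_cutoff_add clinear_on_add[OF T])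
  moreover have "inj_on ?T (cx (Uhat n))" using inj by (simp add: inj_on_def cutoff_cx)
  ultimately obtain C where "Vector_Spaces.linear scaleC scaleC C" "\<forall>u\<in>cx (Uhat n). C (?T u) = u"
    using linear_exists_left_inverse_on[of ?T "cx (Uhat n)"] by auto
  thus ?thesis
    by (intro exI[of _ C]) (auto simp: Vector_Spaces.linear_iff clinear_on_def cutoff_cx)
qed

text \<open>
  The rank is the length of a frame, hence the same at all points.
\<close>

lemma hol_subbundle_zero:
  assumes S: "hol_subbundle U S" and z0: "z0 \<in> U" "S z0 = {0}" and z: "z \<in> U"
  shows "S z = {0}"
proof -
  obtain m :: nat and s where s: "\<And>z. z \<in> U \<Longrightarrow> cvec.independent ((\<lambda>i. s i z) ` {..<m})"
      "\<And>z. z \<in> U \<Longrightarrow> S z = cvec.span ((\<lambda>i. s i z) ` {..<m})"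
    using S unfolding hol_subbundle_def by blast
  have "m = 0"
  proof (rule ccontr)
    assume "m \<noteq> 0"
    hence mem: "s 0 z0 \<in> (\<lambda>i. s i z0) ` {..<m}" by auto
    hence "s 0 z0 \<in> S z0" by (simp add: s(2)[OF z0(1)] cvec.span_base)
    hence "s 0 z0 = 0" using z0(2) by simp
    hence "cvec.dependent ((\<lambda>i. s i z0) ` {..<m})" using mem cvec.dependent_zero by metis
    thus False using s(1)[OF z0(1)] by simp
  qed
  thus ?thesis using s(2)[OF z] by simp
qed

lemma hol_subbundle_line:
  fixes T :: "complex fps \<Rightarrow> 'v::complex_vector"
  assumes S: "hol_subbundle U S" and T: "clinear_on (cx (Uhat n)) T" "inj_on T (cx (Uhat n))"
    and sub: "\<And>z. z \<in> U \<Longrightarrow> S z \<subseteq> T ` cx (Uhat n)"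
    and z0: "z0 \<in> U" "S z0 = cvec.span {x}" "x \<noteq> 0"
  obtains h where "\<And>j. (\<lambda>z. fps_nth (h z) j) holomorphic_on U"
    "\<And>z. z \<in> U \<Longrightarrow> h z \<in> cx (Uhat n) \<and> h z \<noteq> 0 \<and> T (h z) \<in> S z"
proof -
  obtain m :: nat and s where s: "\<And>i. i < m \<Longrightarrow> hol_section U (s i)"
      "\<And>z. z \<in> U \<Longrightarrow> inj_on (\<lambda>i. s i z) {..<m}"
      "\<And>z. z \<in> U \<Longrightarrow> cvec.independent ((\<lambda>i. s i z) ` {..<m})"
      "\<And>z. z \<in> U \<Longrightarrow> S z = cvec.span ((\<lambda>i. s i z) ` {..<m})"
    using S unfolding hol_subbundle_def by blast
  have "cvec.independent {x}" using z0(3) by (simp add: cvec.dependent_single)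
  hence "cvec.dim (cvec.span {x}) = 1" using cvec.dim_span_eq_card_independent[of "{x}"] by simp
  moreover have "cvec.dim (S z0) = card ((\<lambda>i. s i z0) ` {..<m})"
    using cvec.dim_span_eq_card_independent[OF s(3)[OF z0(1)]] s(4)[OF z0(1)] by simp
  ultimately have "m = 1" using z0(2) card_image[OF s(2)[OF z0(1)]] by simp
  hence sec: "hol_section U (s 0)" and ind: "\<And>z. z \<in> U \<Longrightarrow> cvec.independent {s 0 z}"
    and span: "\<And>z. z \<in> U \<Longrightarrow> S z = cvec.span {s 0 z}"
    using s(1,3,4) by (auto simp: lessThan_Suc)
  have s0: "s 0 z \<noteq> 0" "s 0 z \<in> S z" if "z \<in> U" for z
    using ind[OF that] span[OF that] by (auto simp: cvec.dependent_single cvec.span_base)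
  obtain C where C: "clinear_on UNIV C" "\<And>u. u \<in> cx (Uhat n) \<Longrightarrow> C (T u) = u"
    using coordinates_exist[OF T] by blast
  obtain B c where B: "finite B" "\<And>b. b \<in> B \<Longrightarrow> c b holomorphic_on U"
      "\<And>z. z \<in> U \<Longrightarrow> s 0 z = (\<Sum>b\<in>B. c b z *\<^sub>C b)"
    using sec by (auto simp: hol_section_def)
  have C_s0: "C (s 0 z) \<in> cx (Uhat n) \<and> T (C (s 0 z)) = s 0 z" if "z \<in> U" for z
    using s0[OF that] sub[OF that] C(2) by auto
  show ?thesis
  proof
    fix j
    have "fps_nth (C (s 0 z)) j = (\<Sum>b\<in>B. c b z * fps_nth (C b) j)" if "z \<in> U" for z
      by (simp add: B(3)[OF that] clinear_on_sum[OF C(1)] fps_sum_nth)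
    moreover have "(\<lambda>z. \<Sum>b\<in>B. c b z * fps_nth (C b) j) holomorphic_on U"
      using B(2) by (intro holomorphic_intros)
    ultimately show "(\<lambda>z. fps_nth (C (s 0 z)) j) holomorphic_on U"
      by (metis (no_types, lifting) holomorphic_transform)
  next
    fix z assume z: "z \<in> U"
    have "C (s 0 z) \<noteq> 0"
    proof
      assume "C (s 0 z) = 0"
      hence "s 0 z = T 0" using C_s0[OF z] by simp
      thus False using s0(1)[OF z] clinear_on_0[OF T(1)] by simp
    qed
    thus "C (s 0 z) \<in> cx (Uhat n) \<and> C (s 0 z) \<noteq> 0 \<and> T (C (s 0 z)) \<in> S z"
      using C_s0[OF z] s0[OF z] by simp
  qed
qed

section \<open>The period map\<close>

text \<open>
  One level of the logarithmic sheaf. The transition morphisms enter only when the splittings of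
  different levels are compared.
\<close>

locale log_variation =
  fixes V :: "'v::complex_vector variation" and n :: nat and \<iota> :: "complex fps \<Rightarrow> 'v"
  assumes admissible: "admissible_unipotent V"
    and stalk: "mhs_iso (Uhat n) (fibre V 1) \<iota>"
    and monodromy: "\<And>u. u \<in> cx (Uhat n) \<Longrightarrow> \<iota> (Uhat_gamma n u) = transp V gamma_loop (\<iota> u)"
begin

lemma unipotent: "unipotent_vmhs V"
  using admissible by (simp add: admissible_unipotent_def)

lemma vmhs: "vmhs V"
  using unipotent by (simp add: unipotent_vmhs_def)

lemma mhs_fibre: "z \<noteq> 0 \<Longrightarrow> mixed_hodge_structure (fibre V z)"
  using vmhs by (simp add: vmhs_def)

lemma inside_fibre: "z \<noteq> 0 \<Longrightarrow> filtrations_inside (fibre V z)"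
  by (simp add: mhs_fibre filtrations_inside_mhs)

lemmas stalkD = mhs_isoD[OF stalk filtrations_inside_Uhat inside_fibre[of 1, simplified]]

lemma transpD:
  assumes "Gm_path g"
  shows "clinear_on (cx (fibre V (pathstart g))) (transp V g)"
    "bij_betw (transp V g) (cx (fibre V (pathstart g))) (cx (fibre V (pathfinish g)))"
    "transp V g ` lattice (fibre V (pathstart g)) = lattice (fibre V (pathfinish g))"
    "transp V g ` wt (fibre V (pathstart g)) k = wt (fibre V (pathfinish g)) k"
  using vmhs assms by (auto simp: vmhs_def filtered_local_system_def Let_def)

lemma transp_homotopic:
  "homotopic_paths (- {0}) g h \<Longrightarrow> x \<in> cx (fibre V (pathstart g)) \<Longrightarrow> transp V g x = transp V h x"
  using vmhs by (auto simp: vmhs_def filtered_local_system_def)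

lemma transp_join:
  "Gm_path g \<Longrightarrow> Gm_path h \<Longrightarrow> pathfinish g = pathstart h \<Longrightarrow> x \<in> cx (fibre V (pathstart g)) \<Longrightarrow>
    transp V (g +++ h) x = transp V h (transp V g x)"
  using vmhs by (auto simp: vmhs_def filtered_local_system_def)

lemma stalk_in: "u \<in> cx (Uhat n) \<Longrightarrow> \<iota> u \<in> cx (fibre V 1)"
  using stalkD(2) by (auto simp: bij_betw_def)

text \<open>
  The flat multivalued section with value \<open>\<iota> u\<close> at \<open>1\<close>, as a function on the universal cover.
\<close>

definition flat :: "complex \<Rightarrow> complex fps \<Rightarrow> 'v"
  where "flat \<zeta> u = transp V (logpath \<zeta>) (\<iota> u)"

lemma clinear_flat: "clinear_on (cx (Uhat n)) (flat \<zeta>)"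
    and bij_flat: "bij_betw (flat \<zeta>) (cx (Uhat n)) (cx (fibre V (exp \<zeta>)))"
    and flat_lattice: "flat \<zeta> ` lattice (Uhat n) = lattice (fibre V (exp \<zeta>))"
    and flat_wt: "flat \<zeta> ` wt (Uhat n) k = wt (fibre V (exp \<zeta>)) k"
proof -
  note t = transpD[OF Gm_path_logpath[of \<zeta>], unfolded pathstart_logpath pathfinish_logpath]
  show "clinear_on (cx (Uhat n)) (flat \<zeta>)"
    unfolding flat_def using stalk_in by (intro clinear_on_compose[OF stalkD(1) _ t(1)]) auto
  show "bij_betw (flat \<zeta>) (cx (Uhat n)) (cx (fibre V (exp \<zeta>)))"
    using bij_betw_trans[OF stalkD(2) t(2)] by (simp add: flat_def[abs_def] comp_def)
  show "flat \<zeta> ` lattice (Uhat n) = lattice (fibre V (exp \<zeta>))"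
    "flat \<zeta> ` wt (Uhat n) k = wt (fibre V (exp \<zeta>)) k"
    by (simp_all add: flat_def[abs_def] image_image[symmetric] stalkD t)
qed

lemma inj_flat: "inj_on (flat \<zeta>) (cx (Uhat n))"
  and flat_cx: "flat \<zeta> ` cx (Uhat n) = cx (fibre V (exp \<zeta>))"
  using bij_flat by (auto simp: bij_betw_def)

lemma flat_in: "u \<in> cx (Uhat n) \<Longrightarrow> flat \<zeta> u \<in> cx (fibre V (exp \<zeta>))"
  using flat_cx by blast

lemma flat_eq_iff: "u \<in> cx (Uhat n) \<Longrightarrow> v \<in> cx (Uhat n) \<Longrightarrow> flat \<zeta> u = flat \<zeta> v \<longleftrightarrow> u = v"
  using inj_flat by (auto simp: inj_on_def)

lemma flat_wtC: "flat \<zeta> ` wtC (Uhat n) k = wtC (fibre V (exp \<zeta>)) k"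
  unfolding wtC_def
  by (simp add: clinear_on_image_span[OF clinear_flat] wt_Uhat_subset flat_wt)

lemma flat_0:
  assumes u: "u \<in> cx (Uhat n)"
  shows "flat 0 u = \<iota> u"
proof -
  have "linepath 0 0 +++ linepath 0 0 = (linepath 0 0 :: real \<Rightarrow> complex)"
    by (simp add: joinpaths_def linepath_def fun_eq_iff)
  hence join: "logpath 0 +++ logpath 0 = logpath 0"
    by (simp add: logpath_eq flip: path_compose_join)
  have "flat 0 u = transp V (logpath 0) (flat 0 u)"
    using transp_join[of "logpath 0" "logpath 0" "\<iota> u"] stalk_in[OF u] by (simp add: join flat_def)
  hence "transp V (logpath 0) (\<iota> u) = transp V (logpath 0) (flat 0 u)"
    by (simp add: flat_def)
  thus ?thesis
    using transpD(2)[of "logpath 0"] stalk_in[OF u] flat_in[OF u, of 0]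
    by (auto simp: bij_betw_def inj_on_def)
qed

lemma transp_exp_path:
  assumes "path h" "pathstart h = 0" "u \<in> cx (Uhat n)"
  shows "transp V (exp \<circ> h) (\<iota> u) = flat (pathfinish h) u"
  unfolding flat_def using assms stalk_in
  by (intro transp_homotopic homotopic_exp_logpath) (auto simp: pathstart_compose)

lemma flat_2pi:
  assumes u: "u \<in> cx (Uhat n)"
  shows "flat (\<zeta> + 2 * of_real pi * \<i>) u = flat \<zeta> (expmul n 1 u)"
proof -
  let ?p = "2 * of_real pi * \<i>"
  let ?h = "linepath 0 ?p +++ linepath ?p (\<zeta> + ?p)"
  have "exp \<circ> linepath ?p (\<zeta> + ?p) = logpath \<zeta>"
  proof
    fix t
    have "linepath ?p (\<zeta> + ?p) t = of_real t * \<zeta> + ?p"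
      by (simp add: linepath_def scaleR_conv_of_real algebra_simps)
    thus "(exp \<circ> linepath ?p (\<zeta> + ?p)) t = logpath \<zeta> t"
      by (simp add: logpath_def exp_add exp_eq_1)
  qed
  hence "exp \<circ> ?h = gamma_loop +++ logpath \<zeta>"
    by (simp add: path_compose_join gamma_loop_eq logpath_eq)
  moreover have "transp V (exp \<circ> ?h) (\<iota> u) = flat (pathfinish ?h) u"
    using u by (intro transp_exp_path) auto
  ultimately have "flat (\<zeta> + ?p) u = transp V (gamma_loop +++ logpath \<zeta>) (\<iota> u)"
    by simp
  also have "\<dots> = transp V (logpath \<zeta>) (transp V gamma_loop (\<iota> u))"
    using stalk_in[OF u] by (intro transp_join) (auto simp: gamma_loop_eq)
  also have "\<dots> = flat \<zeta> (expmul n 1 u)"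
    by (simp add: flat_def monodromy[OF u, symmetric] Uhat_gamma_eq)
  finally show ?thesis .
qed

text \<open>
  Near \<open>exp \<alpha>\<close> the branch \<open>\<alpha> + Ln (z / exp \<alpha>)\<close> of the logarithm lifts the segment from \<open>exp \<alpha>\<close> to
  \<open>z\<close>, because a disc missing \<open>0\<close> becomes, after division by its centre, a subset of the slit plane.
\<close>

lemma transp_linepath_flat:
  assumes z: "z \<in> ball (exp \<alpha>) r" and r: "0 \<notin> ball (exp \<alpha>) r" and u: "u \<in> cx (Uhat n)"
  shows "transp V (linepath (exp \<alpha>) z) (flat \<alpha> u) = flat (\<alpha> + Ln (z / exp \<alpha>)) u"
    and "exp (\<alpha> + Ln (z / exp \<alpha>)) = z"
proof -
  let ?a = "exp \<alpha>"
  let ?k = "\<lambda>t. \<alpha> + Ln (linepath 1 (z / ?a) t)"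
  have za: "z / ?a \<in> ball 1 1" using divide_in_ball_1[OF r z] .
  have "closed_segment 1 (z / ?a) \<subseteq> ball 1 1"
    using za by (intro closed_segment_subset) auto
  hence seg: "linepath 1 (z / ?a) t \<notin> \<real>\<^sub>\<le>\<^sub>0" if "t \<in> {0..1}" for t
    using that linepath_in_path by (intro ball_1_slit) blast
  have z0: "z \<noteq> 0" using z r by auto
  show fin: "exp (\<alpha> + Ln (z / ?a)) = z" using z0 by (simp add: exp_add)
  have k: "path ?k" unfolding path_def
    using seg by (intro continuous_intros) auto
  have k0: "pathstart ?k = \<alpha>" by (simp add: pathstart_def linepath_def)
  have lin: "(exp \<circ> ?k) t = linepath ?a z t" if "t \<in> {0..1}" for t
  proof -
    have "linepath 1 (z / ?a) t \<noteq> 0" using seg[OF that] by auto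
    hence "(exp \<circ> ?k) t = ?a * linepath 1 (z / ?a) t" by (simp add: exp_add)
    thus ?thesis by (simp add: linepath_def scaleR_conv_of_real algebra_simps)
  qed
  have Gk: "Gm_path (exp \<circ> ?k)" using k by (rule Gm_path_exp)
  have start: "pathstart (exp \<circ> ?k) = ?a" by (simp add: pathstart_def linepath_def)
  have "transp V (linepath ?a z) (flat \<alpha> u) = transp V (exp \<circ> ?k) (flat \<alpha> u)"
  proof (rule transp_homotopic[symmetric])
    show "homotopic_paths (- {0}) (exp \<circ> ?k) (linepath ?a z)"
      using Gk lin by (intro homotopic_paths_eq) (auto simp: Gm_path_def)
  qed (use flat_in[OF u] start in simp)
  also have "\<dots> = transp V (logpath \<alpha> +++ (exp \<circ> ?k)) (\<iota> u)"
    unfolding flat_def using Gk stalk_in[OF u] start by (intro transp_join[symmetric]) auto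
  also have "logpath \<alpha> +++ (exp \<circ> ?k) = exp \<circ> (linepath 0 \<alpha> +++ ?k)"
    by (simp add: path_compose_join logpath_eq)
  also have "transp V \<dots> (\<iota> u) = flat (pathfinish (linepath 0 \<alpha> +++ ?k)) u"
    using u k k0 by (intro transp_exp_path path_join_imp) auto
  also have "pathfinish (linepath 0 \<alpha> +++ ?k) = \<alpha> + Ln (z / ?a)"
    by (simp add: pathfinish_join) (simp add: pathfinish_def linepath_def)
  finally show "transp V (linepath ?a z) (flat \<alpha> u) = flat (\<alpha> + Ln (z / exp \<alpha>)) u" .
qed

text \<open>
  The Hodge filtration over \<open>exp \<zeta>\<close>, moved to the fixed space \<open>U \<otimes> \<complex>\<close> by flat transport; on \<open>U \<otimes> \<complex>\<close>
  this is the lifted period map of the variation.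
\<close>

definition period :: "complex \<Rightarrow> int \<Rightarrow> complex fps set"
  where "period \<zeta> p = {u \<in> cx (Uhat n). flat \<zeta> u \<in> hdg (fibre V (exp \<zeta>)) p}"

lemma period_cx: "u \<in> period \<zeta> p \<Longrightarrow> u \<in> cx (Uhat n)"
  by (simp add: period_def)

lemma flat_period: "flat \<zeta> ` period \<zeta> p = hdg (fibre V (exp \<zeta>)) p"
proof -
  have "hdg (fibre V (exp \<zeta>)) p \<subseteq> flat \<zeta> ` cx (Uhat n)"
    using inside_fibre[of "exp \<zeta>"] flat_cx by (auto simp: filtrations_inside_def)
  thus ?thesis by (auto simp: period_def)
qed

lemma subspace_period: "cvec.subspace (period \<zeta> p)"
proof -
  have "cvec.subspace (hdg (fibre V (exp \<zeta>)) p)"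
    using mhs_fibre[of "exp \<zeta>"] by (auto simp: mixed_hodge_structure_def)
  thus ?thesis
    unfolding period_def by (intro clinear_on_vimage_subspace[OF clinear_flat]) auto
qed

lemma period_antimono:
  assumes "p \<le> p'" shows "period \<zeta> p' \<subseteq> period \<zeta> p"
proof -
  have step: "hdg (fibre V (exp \<zeta>)) (p + 1) \<subseteq> hdg (fibre V (exp \<zeta>)) p" for p
    using mhs_fibre[of "exp \<zeta>"] by (auto simp: mixed_hodge_structure_def)
  have "period \<zeta> (p + int k) \<subseteq> period \<zeta> p" for k
  proof (induction k)
    case (Suc k)
    have "period \<zeta> (p + int k + 1) \<subseteq> period \<zeta> (p + int k)"
      using step[of "p + int k"] by (auto simp: period_def)
    thus ?case using Suc by (auto simp: algebra_simps)
  qed simp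
  from this[of "nat (p' - p)"] assms show ?thesis by simp
qed

lemma period_2pi:
  "u \<in> period (\<zeta> + 2 * of_real pi * \<i>) p \<longleftrightarrow> u \<in> cx (Uhat n) \<and> expmul n 1 u \<in> period \<zeta> p"
proof -
  have "exp (\<zeta> + 2 * of_real pi * \<i>) = exp \<zeta>" by (simp add: exp_add exp_eq_1)
  thus ?thesis by (auto simp: period_def flat_2pi)
qed

text \<open>
  Constancy of the graded pieces: the filtration induced by \<open>F\<^sub>\<zeta>\<close> on the graded pieces of \<open>U\<close> does
  not depend on \<open>\<zeta>\<close>.
\<close>

lemma gr_period:
  "gr_hdg (Uhat n) k p = (period \<zeta> p \<inter> wtC (Uhat n) k) + wtC (Uhat n) (k - 1)"
proof -
  have hdg: "hdg (Uhat n) p \<subseteq> cx (Uhat n)"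
    using filtrations_inside_Uhat by (simp add: filtrations_inside_def)
  have per: "period \<zeta> p \<subseteq> cx (Uhat n)" by (auto simp: period_def)
  have \<iota>wtC: "\<iota> ` wtC (Uhat n) k = wtC (fibre V 1) k" for k
    unfolding wtC_def by (simp add: clinear_on_image_span[OF stalkD(1)] wt_Uhat_subset stalkD)
  have "flat \<zeta> ` gr_hdg (Uhat n) k p = transp V (logpath \<zeta>) ` \<iota> ` gr_hdg (Uhat n) k p"
    by (simp add: flat_def[abs_def] image_image)
  also have "\<iota> ` gr_hdg (Uhat n) k p = gr_hdg (fibre V 1) k p"
    unfolding gr_hdg_def using stalkD(2) hdg
    by (subst gr_hdg_image[OF stalkD(1)]) (auto simp: bij_betw_def wtC_Uhat_subset \<iota>wtC stalkD)
  also have "transp V (logpath \<zeta>) ` \<dots> = gr_hdg (fibre V (exp \<zeta>)) k p"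
    using unipotent Gm_path_logpath[of \<zeta>] unfolding unipotent_vmhs_def
    by (metis pathstart_logpath pathfinish_logpath)
  also have "\<dots> = flat \<zeta> ` ((period \<zeta> p \<inter> wtC (Uhat n) k) + wtC (Uhat n) (k - 1))"
    unfolding gr_hdg_def using per
    by (subst gr_hdg_image[OF clinear_flat inj_flat]) (auto simp: wtC_Uhat_subset flat_period flat_wtC)
  finally have eq: "flat \<zeta> ` gr_hdg (Uhat n) k p = \<dots>" .
  have "A + wtC (Uhat n) (k - 1) \<subseteq> cx (Uhat n)" if "A \<subseteq> cx (Uhat n)" for A
    using that wtC_Uhat_subset[of n "k - 1"]
    by (auto elim!: set_plus_elim intro!: cvec.subspace_add)
  hence "gr_hdg (Uhat n) k p \<subseteq> cx (Uhat n)"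
    "(period \<zeta> p \<inter> wtC (Uhat n) k) + wtC (Uhat n) (k - 1) \<subseteq> cx (Uhat n)"
    unfolding gr_hdg_def using per hdg by blast+
  thus ?thesis using eq inj_on_image_eq_iff[OF inj_flat] by blast
qed

text \<open>
  The graded piece of weight \<open>-2j\<close> is of type \<open>(-j,-j)\<close>, so \<open>F\<^sup>p\<close> is zero on it for \<open>p > -j\<close>.
\<close>

lemma period_leading_zero:
  assumes u: "u \<in> period \<zeta> p" and zero: "\<And>i. i < j \<Longrightarrow> fps_nth u i = 0" and p: "- int j < p"
  shows "fps_nth u j = 0"
proof (cases "j \<le> n")
  case True
  have "u \<in> wtC (Uhat n) (- 2 * int j)"
    using u zero by (fastforce simp: wtC_Uhat period_def cx_Uhat not_less[symmetric])
  hence "u + 0 \<in> gr_hdg (Uhat n) (- 2 * int j) p"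
    unfolding gr_period[of _ _ \<zeta>] using u by (intro set_plus_intro) (auto simp: cvec.subspace_0)
  then obtain x y where "u = x + y" "x \<in> hdg (Uhat n) p" "y \<in> wtC (Uhat n) (- 2 * int j - 1)"
    unfolding gr_hdg_def by (auto elim!: set_plus_elim)
  moreover have "fps_nth x j = 0" using calculation(2) p by (fastforce simp: hdg_Uhat)
  moreover have "fps_nth y j = 0" using calculation(3) by (fastforce simp: wtC_Uhat)
  ultimately show ?thesis by simp
qed (use u in \<open>auto simp: period_def cx_Uhat\<close>)

lemma period_eq_0:
  assumes u: "u \<in> period \<zeta> p" and supp: "\<And>i. fps_nth u i \<noteq> 0 \<Longrightarrow> - int i < p"
  shows "u = 0"
proof -
  have "fps_nth u i = 0" for i
  proof (induction i rule: less_induct)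
    case (less i)
    thus ?case using period_leading_zero[OF u, of i] supp[of i] by blast
  qed
  thus ?thesis by (simp add: fps_eq_iff)
qed

text \<open>
  The case \<open>p = 0\<close>, \<open>k = 0\<close> of constancy: \<open>F\<^sup>0\<close> maps onto the graded piece \<open>\<rat>(0)\<close>.
\<close>

lemma period_line_ex: "\<exists>v. v \<in> period \<zeta> 0 \<and> fps_nth v 0 = 1"
proof -
  have "1 + 0 \<in> gr_hdg (Uhat n) 0 0"
    unfolding gr_hdg_def
    by (intro set_plus_intro) (auto simp: hdg_Uhat wtC_Uhat cvec.subspace_0)
  then obtain x y where xy: "1 = x + y" "x \<in> period \<zeta> 0" "y \<in> wtC (Uhat n) (- 1)"
    unfolding gr_period[of _ _ \<zeta>] by (auto elim!: set_plus_elim)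
  have "fps_nth y 0 = 0" using xy(3) by (auto simp: wtC_Uhat)
  hence "fps_nth x 0 = fps_nth (x + y) 0" by simp
  also have "\<dots> = 1" by (simp flip: xy(1))
  finally show ?thesis using xy(2) by blast
qed

definition generator :: "complex \<Rightarrow> complex fps"
  where "generator \<zeta> = (SOME v. v \<in> period \<zeta> 0 \<and> fps_nth v 0 = 1)"

lemma generator: "generator \<zeta> \<in> period \<zeta> 0" "fps_nth (generator \<zeta>) 0 = 1"
  using someI_ex[OF period_line_ex[of \<zeta>]] by (auto simp: generator_def)

lemma period_line: 
  assumes u: "u \<in> period \<zeta> 0"
  shows "u = fps_nth u 0 *\<^sub>C generator \<zeta>"
proof -
  have "u - fps_nth u 0 *\<^sub>C generator \<zeta> \<in> period \<zeta> 0"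
    by (intro cvec.subspace_diff[OF subspace_period] u cvec.subspace_scale[OF subspace_period] generator)
  hence "u - fps_nth u 0 *\<^sub>C generator \<zeta> = 0"
  proof (rule period_eq_0)
    fix i assume "fps_nth (u - fps_nth u 0 *\<^sub>C generator \<zeta>) i \<noteq> 0"
    thus "- int i < 0" by (cases i) (auto simp: generator)
  qed
  thus ?thesis by simp
qed

lemma period_0_eq: "period \<zeta> 0 = range (\<lambda>c. c *\<^sub>C generator \<zeta>)"
  using period_line generator(1) cvec.subspace_scale[OF subspace_period] by blast

lemma generator_2pi: "generator (\<zeta> + 2 * of_real pi * \<i>) = expmul n (- 1) (generator \<zeta>)"
proof -
  have "expmul n (- 1) (generator \<zeta>) \<in> period (\<zeta> + 2 * of_real pi * \<i>) 0"
    using generator(1) period_cx[OF generator(1)] by (simp add: period_2pi expmul_cancel)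
  from period_line[OF this] show ?thesis by (simp add: generator)
qed

section \<open>Holomorphic dependence on the base point\<close>

abbreviation tpi :: complex where "tpi \<equiv> 2 * of_real pi * \<i>"

lemma flat_hdg_eq:
  assumes r: "0 \<notin> ball (exp \<alpha>) r" and z: "z \<in> ball (exp \<alpha>) r"
  shows "flat_hdg V (exp \<alpha>) p z = flat \<alpha> ` period (\<alpha> + Ln (z / exp \<alpha>)) p"
proof -
  have "flat_hdg V (exp \<alpha>) p z = {x \<in> flat \<alpha> ` cx (Uhat n). transp V (linepath (exp \<alpha>) z) x \<in> hdg (fibre V z) p}"
    by (simp add: flat_hdg_def flat_cx)
  also have "\<dots> = flat \<alpha> ` period (\<alpha> + Ln (z / exp \<alpha>)) p"
    using transp_linepath_flat[OF z r] by (auto simp: period_def)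
  finally show ?thesis .
qed

lemma generator_nonzero: "generator \<zeta> \<noteq> 0"
  using generator(2)[of \<zeta>] by auto

lemma generator_unique:
  assumes "u \<in> period \<zeta> 0" "u \<noteq> 0"
  shows "fps_nth u 0 \<noteq> 0" "fps_nth (generator \<zeta>) j = fps_nth u j / fps_nth u 0"
proof -
  have u: "u = fps_nth u 0 *\<^sub>C generator \<zeta>" using period_line[OF assms(1)] .
  show 0: "fps_nth u 0 \<noteq> 0"
  proof
    assume "fps_nth u 0 = 0"
    with u have "u = 0 *\<^sub>C generator \<zeta>" by simp
    thus False using assms(2) by simp
  qed
  have "fps_nth u j = fps_nth u 0 * fps_nth (generator \<zeta>) j" by (subst u) simp
  thus "fps_nth (generator \<zeta>) j = fps_nth u j / fps_nth u 0" using 0 by simp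
qed

lemma flat_period_0: "flat \<alpha> ` period \<zeta> 0 = cvec.span {flat \<alpha> (generator \<zeta>)}"
proof -
  have "flat \<alpha> ` period \<zeta> 0 = range (\<lambda>c. flat \<alpha> (c *\<^sub>C generator \<zeta>))"
    by (simp add: period_0_eq image_image)
  also have "\<dots> = range (\<lambda>c. c *\<^sub>C flat \<alpha> (generator \<zeta>))"
    using period_cx[OF generator(1)] by (simp add: clinear_on_scale[OF clinear_flat])
  finally show ?thesis by (simp add: cvec.span_singleton)
qed

text \<open>
  Over a small disc \<open>F\<^sup>0\<close> has a holomorphic frame, consisting of a single section since \<open>F\<^sup>0\<close> is a
  line; the generator is that section divided by its constant coefficient, which never vanishes.
\<close>

lemma generator_holomorphic: "(\<lambda>\<zeta>. fps_nth (generator \<zeta>) j) holomorphic_on UNIV"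
proof (rule analytic_imp_holomorphic, unfold analytic_on_def, intro ballI)
  fix \<alpha> :: complex
  let ?a = "exp \<alpha>"
  obtain r where r: "r > 0" "0 \<notin> ball ?a r" "hol_subbundle (ball ?a r) (flat_hdg V ?a 0)"
    using vmhs exp_not_eq_zero[of \<alpha>] unfolding vmhs_def by blast
  have a: "?a \<in> ball ?a r" using r(1) by simp
  have sub: "flat_hdg V ?a 0 z \<subseteq> flat \<alpha> ` cx (Uhat n)" for z
    by (auto simp: flat_hdg_def flat_cx)
  have line: "flat_hdg V ?a 0 ?a = cvec.span {flat \<alpha> (generator \<alpha>)}"
    using flat_hdg_eq[OF r(2) a] by (simp add: flat_period_0)
  have nz: "flat \<alpha> (generator \<alpha>) \<noteq> 0"
  proof
    assume "flat \<alpha> (generator \<alpha>) = 0"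
    hence "flat \<alpha> (generator \<alpha>) = flat \<alpha> 0" by (simp add: clinear_on_0[OF clinear_flat])
    thus False using period_cx[OF generator(1)] generator_nonzero
      by (simp add: flat_eq_iff cvec.subspace_0)
  qed
  obtain h where hol: "\<And>j. (\<lambda>z. fps_nth (h z) j) holomorphic_on ball ?a r"
    and h: "\<And>z. z \<in> ball ?a r \<Longrightarrow> h z \<in> cx (Uhat n) \<and> h z \<noteq> 0 \<and> flat \<alpha> (h z) \<in> flat_hdg V ?a 0 z"
    using hol_subbundle_line[OF r(3) clinear_flat inj_flat sub a line nz] by blast
  have h_period: "h z \<in> period (\<alpha> + Ln (z / ?a)) 0" "h z \<noteq> 0" if z: "z \<in> ball ?a r" for z
  proof -
    obtain u where "flat \<alpha> (h z) = flat \<alpha> u" "u \<in> period (\<alpha> + Ln (z / ?a)) 0"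
      using h[OF z] flat_hdg_eq[OF r(2) z] by auto
    thus "h z \<in> period (\<alpha> + Ln (z / ?a)) 0" using h[OF z] period_cx by (simp add: flat_eq_iff)
    show "h z \<noteq> 0" using h[OF z] by simp
  qed
  have "isCont exp \<alpha>" by simp
  then obtain d where d: "d > 0" "\<And>\<zeta>. dist \<zeta> \<alpha> < d \<Longrightarrow> dist (exp \<zeta>) ?a < r"
    using r(1) unfolding continuous_at_eps_delta by blast
  define e where "e = min d pi"
  have exp_ball: "exp ` ball \<alpha> e \<subseteq> ball ?a r"
    using d(2) by (auto simp: e_def dist_commute)
  have eq: "fps_nth (generator \<zeta>) j = fps_nth (h (exp \<zeta>)) j / fps_nth (h (exp \<zeta>)) 0"
    and nonzero: "fps_nth (h (exp \<zeta>)) 0 \<noteq> 0" if \<zeta>: "\<zeta> \<in> ball \<alpha> e" for \<zeta>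
  proof -
    have "\<bar>Im (\<zeta> - \<alpha>)\<bar> < pi"
      using \<zeta> abs_Im_le_cmod[of "\<zeta> - \<alpha>"] by (auto simp: e_def dist_norm norm_minus_commute)
    hence "Ln (exp \<zeta> / ?a) = \<zeta> - \<alpha>" by (simp flip: exp_diff)
    moreover have "exp \<zeta> \<in> ball ?a r" using exp_ball \<zeta> by blast
    ultimately have "h (exp \<zeta>) \<in> period \<zeta> 0" "h (exp \<zeta>) \<noteq> 0" using h_period[of "exp \<zeta>"] by simp_all
    from generator_unique[OF this] 
    show "fps_nth (generator \<zeta>) j = fps_nth (h (exp \<zeta>)) j / fps_nth (h (exp \<zeta>)) 0"
      "fps_nth (h (exp \<zeta>)) 0 \<noteq> 0" by auto
  qed
  have hol': "(\<lambda>\<zeta>. fps_nth (h (exp \<zeta>)) j) holomorphic_on ball \<alpha> e" for j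
    using holomorphic_on_compose_gen[OF _ hol exp_ball, of j]
    by (simp add: comp_def holomorphic_intros)
  have "(\<lambda>\<zeta>. fps_nth (h (exp \<zeta>)) j / fps_nth (h (exp \<zeta>)) 0) holomorphic_on ball \<alpha> e"
    using nonzero by (intro holomorphic_intros hol') auto
  hence "(\<lambda>\<zeta>. fps_nth (generator \<zeta>) j) holomorphic_on ball \<alpha> e"
    using eq by (metis (no_types, lifting) holomorphic_transform)
  thus "\<exists>e>0. (\<lambda>\<zeta>. fps_nth (generator \<zeta>) j) holomorphic_on ball \<alpha> e"
    using d(1) by (intro exI[of _ e]) (auto simp: e_def)
qed

text \<open>
  The coordinates of the generator of \<open>F\<^sup>0\<close> in the frame of the canonical extension: the twist
  undoes the monodromy, so this descends to a function of \<open>exp \<zeta>\<close>.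
\<close>

definition untwisted :: "complex \<Rightarrow> complex fps"
  where "untwisted \<zeta> = expmul n (\<zeta> / tpi) (generator \<zeta>)"

lemma untwisted_0 [simp]: "fps_nth (untwisted \<zeta>) 0 = 1"
  by (simp add: untwisted_def generator)

lemma untwisted_cx [simp]: "untwisted \<zeta> \<in> cx (Uhat n)"
  by (simp add: untwisted_def)

lemma untwisted_holomorphic: "(\<lambda>\<zeta>. fps_nth (untwisted \<zeta>) j) holomorphic_on UNIV"
  unfolding untwisted_def nth_expmul
  by (cases "j \<le> n") (auto intro!: holomorphic_intros generator_holomorphic)

lemma untwisted_2pi: "untwisted (\<zeta> + tpi) = untwisted \<zeta>"
proof -
  have "(\<zeta> + tpi) / tpi + (- 1) = \<zeta> / tpi" by (simp add: field_simps)
  thus ?thesis by (simp only: untwisted_def generator_2pi expmul_add)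
qed

lemma untwisted_exp_cong:
  assumes "exp \<zeta> = exp \<zeta>'" shows "untwisted \<zeta> = untwisted \<zeta>'"
proof -
  interpret periodic_fun_simple untwisted tpi by standard (rule untwisted_2pi)
  obtain k :: int where "\<zeta> = \<zeta>' + (of_int (2 * k) * pi) * \<i>"
    using assms by (auto simp: exp_eq)
  hence "\<zeta> = \<zeta>' + of_int k * tpi" by simp
  thus ?thesis using plus_of_int by simp
qed

lemma mem_period_0: "u \<in> period 0 p \<longleftrightarrow> u \<in> hdg (Uhat n) p"
proof -
  have sub: "hdg (Uhat n) p \<subseteq> cx (Uhat n)"
    using filtrations_inside_Uhat by (simp add: filtrations_inside_def)
  have inj: "inj_on \<iota> (cx (Uhat n))" using stalkD(2) by (simp add: bij_betw_def)
  have "flat 0 u \<in> hdg (fibre V (exp 0)) p \<longleftrightarrow> u \<in> hdg (Uhat n) p" if "u \<in> cx (Uhat n)"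
    using inj_on_image_mem_iff[OF inj that sub] that by (simp add: flat_0 stalkD(5))
  thus ?thesis using sub by (auto simp: period_def)
qed

lemma untwisted_at_0: "untwisted 0 = 1"
proof -
  have "1 \<in> period 0 0" by (simp add: mem_period_0 hdg_Uhat)
  from period_line[OF this] have "generator 0 = 1" by simp
  moreover have "1 \<in> cx (Uhat n)" by (simp add: cx_Uhat)
  ultimately show ?thesis by (simp add: untwisted_def expmul_0)
qed

section \<open>Extension across the punctures\<close>

lemma log_monodromy_stalk:
  "u \<in> cx (Uhat n) \<Longrightarrow> log_monodromy V (\<iota> u) = \<iota> (fps_cutoff (Suc n) (fps_const 1 * fps_X * u))"
  unfolding log_monodromy_def
  using monodromy by (intro ulog_expmul[OF stalkD(1)]) (auto simp: Uhat_gamma_eq)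

lemma canonical_frame_0:
  assumes u: "u \<in> cx (Uhat n)"
  shows "canonical_frame V z (\<iota> u) = flat (Ln z) (expmul n (- (Ln z / tpi)) u)"
  using nexp_X[OF stalkD(1) u log_monodromy_stalk, of "- (Ln z / tpi)"]
  by (simp add: canonical_frame_def flat_def logpath_def)

text \<open>
  The inversion reverses the loop, so the monodromy logarithm changes sign. The reversed loop is
  the exponential path of \<open>-2\<pi>i\<close>, and its transport is found by adding \<open>2\<pi>i\<close> to the end point.
\<close>

lemma log_monodromy_inverse:
  assumes u: "u \<in> cx (Uhat n)"
  shows "log_monodromy (pullback inverse V) (\<iota> u) = \<iota> (fps_cutoff (Suc n) (fps_const (- 1) * fps_X * u))"
proof -
  have "transp (pullback inverse V) gamma_loop (\<iota> u) = \<iota> (expmul n (- 1) u)" if u: "u \<in> cx (Uhat n)" for u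
  proof -
    have "inverse \<circ> gamma_loop = logpath (- tpi)"
      by (auto simp: gamma_loop_eq logpath_def fun_eq_iff exp_minus)
    hence "transp (pullback inverse V) gamma_loop (\<iota> u) = flat (- tpi) u"
      by (simp add: pullback_def flat_def)
    also have "\<dots> = flat (- tpi) (expmul n 1 (expmul n (- 1) u))"
      using u by (simp add: expmul_cancel)
    also have "\<dots> = flat 0 (expmul n (- 1) u)"
      using flat_2pi[of "expmul n (- 1) u" "- tpi"] by simp
    finally show ?thesis by (simp add: flat_0)
  qed
  thus ?thesis
    unfolding log_monodromy_def using u by (intro ulog_expmul[OF stalkD(1)]) auto
qed

lemma canonical_frame_infinity:
  assumes u: "u \<in> cx (Uhat n)"
  shows "canonical_frame (pullback inverse V) z (\<iota> u) = flat (- Ln z) (expmul n (Ln z / tpi) u)"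
proof -
  have "inverse \<circ> logpath (Ln z) = logpath (- Ln z)"
    by (auto simp: logpath_def fun_eq_iff exp_minus)
  moreover have "canonical_frame (pullback inverse V) z (\<iota> u) =
      transp V (inverse \<circ> logpath (Ln z)) (nexp (\<lambda>x. (- (Ln z / tpi)) *\<^sub>C log_monodromy (pullback inverse V) x) (\<iota> u))"
    by (simp add: canonical_frame_def pullback_def logpath_def)
  ultimately show ?thesis
    using nexp_X[OF stalkD(1) u log_monodromy_inverse, of "- (Ln z / tpi)"]
    by (simp add: flat_def)
qed

text \<open>
  Both punctures are covered: \<open>\<sigma> = 1\<close> for \<open>0\<close> and \<open>\<sigma> = -1\<close> for \<open>\<infinity>\<close>. The extended line bundle \<open>F\<^sup>0\<close> has
  a holomorphic frame \<open>h\<close> near the puncture, and the function in question is \<open>h\<close> divided by its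
  constant coefficient. That this coefficient does not vanish at the puncture is where compatibility
  with the weight filtration is needed: otherwise \<open>h(0)\<close> would be a non-zero element of the limit of
  \<open>F\<^sup>0 \<inter> W\<^sub>-\<^sub>1\<close>, but this bundle is zero off the puncture and hence also at it.
\<close>

lemma bounded_at_puncture:
  fixes \<sigma> :: complex
  assumes adm: "admissible_at_0 V'"
    and fib1: "fibre V' 1 = fibre V 1"
    and fib: "\<And>z. z \<noteq> 0 \<Longrightarrow> fibre V' z = fibre V (exp (\<sigma> * Ln z))"
    and frame: "\<And>z u. z \<noteq> 0 \<Longrightarrow> u \<in> cx (Uhat n) \<Longrightarrow>
      canonical_frame V' z (\<iota> u) = flat (\<sigma> * Ln z) (expmul n (- (\<sigma> * Ln z / tpi)) u)"
  shows "\<exists>r>0. \<forall>j. bounded ((\<lambda>z. fps_nth (untwisted (\<sigma> * Ln z)) j) ` (ball 0 r - {0}))"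
proof -
  obtain L r where r: "r > 0" and hol: "\<And>p k. hol_subbundle (ball 0 r)
       (\<lambda>z. if z = 0 then L p \<inter> wtC (fibre V' 1) k
            else {v \<in> cx (fibre V' 1).
                    canonical_frame V' z v \<in> hdg (fibre V' z) p \<inter> wtC (fibre V' z) k})"
    using adm by (auto simp: admissible_at_0_def)
  define S where "S k z = (if z = 0 then L 0 \<inter> wtC (fibre V' 1) k
            else {v \<in> cx (fibre V' 1).
                    canonical_frame V' z v \<in> hdg (fibre V' z) 0 \<inter> wtC (fibre V' z) k})" for k z
  have S_hol: "hol_subbundle (ball 0 r) (S k)" for k
    unfolding S_def[abs_def] by (rule hol)
  have cx1: "cx (fibre V' 1) = \<iota> ` cx (Uhat n)"
    using stalkD(2) by (simp add: fib1 bij_betw_def)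
  have wtC1: "wtC (fibre V' 1) k = \<iota> ` wtC (Uhat n) k" for k
    using flat_wtC[of 0 k] by (simp add: fib1 flat_0 wtC_Uhat_subset[THEN subsetD])
  have S_sub: "S k z \<subseteq> \<iota> ` cx (Uhat n)" for k z
    using wtC_Uhat_subset by (auto simp: S_def cx1 wtC1)
  have inj: "inj_on \<iota> (cx (Uhat n))" using stalkD(2) by (simp add: bij_betw_def)
  have S_mem: "\<iota> u \<in> S k z \<longleftrightarrow> expmul n (- (\<sigma> * Ln z / tpi)) u \<in> period (\<sigma> * Ln z) 0 \<inter> wtC (Uhat n) k"
    if z: "z \<noteq> 0" and u: "u \<in> cx (Uhat n)" for u k z
  proof -
    let ?e = "expmul n (- (\<sigma> * Ln z / tpi)) u"
    have "flat (\<sigma> * Ln z) ?e \<in> wtC (fibre V (exp (\<sigma> * Ln z))) k \<longleftrightarrow> ?e \<in> wtC (Uhat n) k"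
      unfolding flat_wtC[symmetric]
      using inj_on_image_mem_iff[OF inj_flat, of ?e "wtC (Uhat n) k"] wtC_Uhat_subset by simp
    moreover have "\<iota> u \<in> cx (fibre V' 1)" using u cx1 by auto
    ultimately show ?thesis using u z
      by (simp add: S_def frame fib period_def)
  qed
  define z0 where "z0 = complex_of_real (r / 2)"
  have z0: "z0 \<noteq> 0" "z0 \<in> ball 0 r" using r by (auto simp: z0_def dist_norm)
  have untwisted_eq: "u = fps_nth u 0 *\<^sub>C untwisted (\<sigma> * Ln z)"
    if z: "z \<noteq> 0" and u: "u \<in> cx (Uhat n)" and S: "\<iota> u \<in> S k z" for u k z
  proof -
    let ?c = "\<sigma> * Ln z / tpi"
    have "expmul n (- ?c) u \<in> period (\<sigma> * Ln z) 0" using S_mem[OF z u, of k] S by auto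
    from period_line[OF this] have eq: "expmul n (- ?c) u = fps_nth u 0 *\<^sub>C generator (\<sigma> * Ln z)" by simp
    have "u = expmul n ?c (expmul n (- ?c) u)" using u by (simp add: expmul_cancel)
    also have "\<dots> = fps_nth u 0 *\<^sub>C untwisted (\<sigma> * Ln z)"
      unfolding eq untwisted_def by (rule clinear_on_scale[OF clinear_expmul[of UNIV]]) auto
    finally show ?thesis .
  qed
  have untwisted_S: "\<iota> (untwisted (\<sigma> * Ln z)) \<in> S 0 z" if "z \<noteq> 0" for z
  proof -
    have "expmul n (- (\<sigma> * Ln z / tpi)) (untwisted (\<sigma> * Ln z)) = generator (\<sigma> * Ln z)"
      unfolding untwisted_def by (rule expmul_cancel) (auto intro: period_cx generator)
    moreover have "generator (\<sigma> * Ln z) \<in> wtC (Uhat n) 0"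
      using period_cx[OF generator(1)[of "\<sigma> * Ln z"]] by (auto simp: wtC_Uhat cx_Uhat not_le[symmetric])
    ultimately show ?thesis using that generator(1) by (simp add: S_mem)
  qed
  have S_zero: "S (- 1) z0 = {0}"
  proof
    show "S (- 1) z0 \<subseteq> {0}"
    proof
      fix x assume x: "x \<in> S (- 1) z0"
      then obtain u where u: "u \<in> cx (Uhat n)" "x = \<iota> u" using S_sub by blast
      let ?e = "expmul n (- (\<sigma> * Ln z0 / tpi)) u"
      have "?e \<in> wtC (Uhat n) (- 1)" using S_mem[OF z0(1) u(1), of "-1"] x u(2) by auto
      hence "fps_nth ?e 0 \<noteq> 0 \<longrightarrow> - 2 * int 0 \<le> (- 1 :: int)" unfolding wtC_Uhat by blast
      hence "fps_nth ?e 0 = 0" by simp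
      hence "fps_nth u 0 = 0" by simp
      hence "u = 0" using untwisted_eq[OF z0(1) u(1), of "-1"] x u(2) by simp
      thus "x \<in> {0}" using u by (simp add: clinear_on_0[OF stalkD(1)])
    qed
    have "\<iota> 0 \<in> S (- 1) z0"
      using clinear_on_0[OF clinear_expmul[of "UNIV"]] 
      by (subst S_mem[OF z0(1)]) (auto simp: cvec.subspace_0 subspace_period)
    thus "{0} \<subseteq> S (- 1) z0" by (simp add: clinear_on_0[OF stalkD(1)])
  qed
  have "S (- 1) 0 = {0}"
    using hol_subbundle_zero[OF S_hol z0(2) S_zero, of 0] r by simp
  have line: "S 0 z0 = cvec.span {\<iota> (untwisted (\<sigma> * Ln z0))}"
  proof (intro equalityI subsetI)
    fix x assume x: "x \<in> S 0 z0"
    then obtain u where u: "u \<in> cx (Uhat n)" "x = \<iota> u" using S_sub by blast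
    have "x = \<iota> (fps_nth u 0 *\<^sub>C untwisted (\<sigma> * Ln z0))" using untwisted_eq[OF z0(1) u(1)] x u(2) by metis
    also have "\<dots> = fps_nth u 0 *\<^sub>C \<iota> (untwisted (\<sigma> * Ln z0))"
      by (simp add: clinear_on_scale[OF stalkD(1)])
    finally show "x \<in> cvec.span {\<iota> (untwisted (\<sigma> * Ln z0))}" by (auto simp: cvec.span_singleton)
  next
    have "cvec.subspace (S 0 z0)"
      using S_hol[of 0] z0(2) by (auto simp: hol_subbundle_def)
    thus "x \<in> S 0 z0" if "x \<in> cvec.span {\<iota> (untwisted (\<sigma> * Ln z0))}" for x
      using that cvec.span_minimal[of "{\<iota> (untwisted (\<sigma> * Ln z0))}" "S 0 z0"] untwisted_S[OF z0(1)] by auto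
  qed
  have nz: "\<iota> (untwisted (\<sigma> * Ln z0)) \<noteq> 0"
  proof
    assume "\<iota> (untwisted (\<sigma> * Ln z0)) = 0"
    hence "untwisted (\<sigma> * Ln z0) = 0"
      using inj clinear_on_0[OF stalkD(1)] by (auto simp: inj_on_def cvec.subspace_0)
    thus False using untwisted_0[of "\<sigma> * Ln z0"] by simp
  qed
  obtain h where h_hol: "\<And>j. (\<lambda>z. fps_nth (h z) j) holomorphic_on ball 0 r"
    and h: "\<And>z. z \<in> ball 0 r \<Longrightarrow> h z \<in> cx (Uhat n) \<and> h z \<noteq> 0 \<and> \<iota> (h z) \<in> S 0 z"
    using hol_subbundle_line[OF S_hol stalkD(1) inj S_sub z0(2) line nz] by blast
  have h0: "fps_nth (h z) 0 \<noteq> 0" if z: "z \<in> ball 0 r" for z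
  proof
    assume 0: "fps_nth (h z) 0 = 0"
    show False
    proof (cases "z = 0")
      case True
      have "i \<le> n \<and> - 2 * int i \<le> - 1" if "fps_nth (h 0) i \<noteq> 0" for i
        using that h[OF z] 0 True by (cases i) (auto simp: cx_Uhat not_le[symmetric])
      hence "h 0 \<in> wtC (Uhat n) (- 1)" by (simp add: wtC_Uhat)
      hence "\<iota> (h 0) \<in> S (- 1) 0" using h[OF z] True by (simp add: S_def wtC1)
      hence "\<iota> (h 0) = \<iota> 0" using \<open>S (- 1) 0 = {0}\<close> by (simp add: clinear_on_0[OF stalkD(1)])
      thus False using h[OF z] True inj by (auto simp: inj_on_def cvec.subspace_0)
    next
      case False
      thus False using untwisted_eq[OF False] h[OF z] 0 by (metis cvec.scale_zero_left)
    qed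
  qed
  have "bounded ((\<lambda>z. fps_nth (untwisted (\<sigma> * Ln z)) j) ` (ball 0 (r / 2) - {0}))" for j
  proof -
    let ?q = "\<lambda>z. fps_nth (h z) j / fps_nth (h z) 0"
    have sub: "cball 0 (r / 2) \<subseteq> ball (0 :: complex) r" using r by auto
    have "continuous_on (cball 0 (r / 2)) ?q"
      using h0 sub h_hol
      by (intro continuous_intros holomorphic_on_imp_continuous_on[OF holomorphic_on_subset[OF h_hol]]) auto
    hence "bounded (?q ` cball 0 (r / 2))"
      by (intro compact_imp_bounded compact_continuous_image) auto
    moreover have "fps_nth (untwisted (\<sigma> * Ln z)) j = ?q z" if z: "z \<in> ball 0 (r / 2) - {0}" for z
    proof -
      have z': "z \<in> ball 0 r" "z \<noteq> 0" using z r by auto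
      have "h z = fps_nth (h z) 0 *\<^sub>C untwisted (\<sigma> * Ln z)" using untwisted_eq[OF z'(2)] h[OF z'(1)] by blast
      hence "fps_nth (h z) j = fps_nth (h z) 0 * fps_nth (untwisted (\<sigma> * Ln z)) j"
        by (metis fps_nth_scaleC)
      thus ?thesis using h0[OF z'(1)] by simp
    qed
    hence "(\<lambda>z. fps_nth (untwisted (\<sigma> * Ln z)) j) ` (ball 0 (r / 2) - {0}) \<subseteq> ?q ` cball 0 (r / 2)"
      by (auto simp: image_iff)
    ultimately show ?thesis by (rule bounded_subset)
  qed
  thus ?thesis using r by (intro exI[of _ "r / 2"]) auto
qed

text \<open>
  The plane is covered by two half planes, whose images under \<open>exp\<close> are punctured neighbourhoods of
  \<open>0\<close> and \<open>\<infinity>\<close>, and a strip. By periodicity the values on the strip are taken on a compact rectangle.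
  So the function is entire and bounded.
\<close>

lemma untwisted_eq_1: "untwisted \<zeta> = 1"
proof -
  have adm: "admissible_at_0 V" "admissible_at_0 (pullback inverse V)"
    using admissible by (auto simp: admissible_unipotent_def)
  have "\<exists>r>0. \<forall>j. bounded ((\<lambda>z. fps_nth (untwisted (1 * Ln z)) j) ` (ball 0 r - {0}))"
    using adm(1) by (rule bounded_at_puncture) (auto simp: canonical_frame_0)
  then obtain r where r: "r > 0" "\<And>j. bounded ((\<lambda>z. fps_nth (untwisted (Ln z)) j) ` (ball 0 r - {0}))"
    by auto
  have "\<exists>r>0. \<forall>j. bounded ((\<lambda>z. fps_nth (untwisted (- 1 * Ln z)) j) ` (ball 0 r - {0}))"
    using adm(2)
  proof (rule bounded_at_puncture)
    show "fibre (pullback inverse V) z = fibre V (exp (- 1 * Ln z))" if "z \<noteq> 0" for z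
      using that by (simp add: pullback_def exp_minus)
  qed (simp_all add: canonical_frame_infinity pullback_def[of _ V, THEN arg_cong[where f = fibre]])
  then obtain r' where r': "r' > 0" "\<And>j. bounded ((\<lambda>z. fps_nth (untwisted (- Ln z)) j) ` (ball 0 r' - {0}))"
    by auto
  have "fps_nth (untwisted \<zeta>) j = fps_nth (untwisted 0) j" for j
  proof -
    let ?f = "\<lambda>\<zeta>. fps_nth (untwisted \<zeta>) j"
    define K where "K = cbox (Complex (ln r) (- pi)) (Complex (- ln r') pi)"
    have "bounded (?f ` K)"
      unfolding K_def
      by (intro compact_imp_bounded compact_continuous_image holomorphic_on_imp_continuous_on
          holomorphic_on_subset[OF untwisted_holomorphic]) auto
    hence bd: "bounded (((\<lambda>z. ?f (Ln z)) ` (ball 0 r - {0})) \<union> ((\<lambda>z. ?f (- Ln z)) ` (ball 0 r' - {0})) \<union> ?f ` K)"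
      using r(2)[of j] r'(2)[of j] by simp
    have "range ?f \<subseteq> ((\<lambda>z. ?f (Ln z)) ` (ball 0 r - {0})) \<union> ((\<lambda>z. ?f (- Ln z)) ` (ball 0 r' - {0})) \<union> ?f ` K"
    proof
      fix y assume "y \<in> range ?f"
      then obtain \<zeta> where y: "y = ?f \<zeta>" by blast
      consider "Re \<zeta> < ln r" | "Re \<zeta> > - ln r'" | "ln r \<le> Re \<zeta>" "Re \<zeta> \<le> - ln r'" by linarith
      thus "y \<in> ((\<lambda>z. ?f (Ln z)) ` (ball 0 r - {0})) \<union> ((\<lambda>z. ?f (- Ln z)) ` (ball 0 r' - {0})) \<union> ?f ` K"
      proof cases
        case 1
        hence "exp (Re \<zeta>) < r" using r(1) by (metis exp_less_cancel_iff exp_ln)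
        hence "exp \<zeta> \<in> ball 0 r - {0}" by simp
        moreover have "y = ?f (Ln (exp \<zeta>))"
          unfolding y by (subst untwisted_exp_cong[of \<zeta> "Ln (exp \<zeta>)"]) auto
        ultimately show ?thesis by blast
      next
        case 2
        hence "exp (- Re \<zeta>) < r'" using r'(1) by (metis exp_less_cancel_iff exp_ln minus_less_iff)
        hence "exp (- \<zeta>) \<in> ball 0 r' - {0}" by simp
        moreover have "y = ?f (- Ln (exp (- \<zeta>)))"
          unfolding y by (subst untwisted_exp_cong[of \<zeta> "- Ln (exp (- \<zeta>))"]) (auto simp: exp_minus)
        ultimately show ?thesis by blast
      next
        case 3
        have "Re (Ln (exp \<zeta>)) = Re \<zeta>" by simp
        hence "Ln (exp \<zeta>) \<in> K"
          using 3 mpi_less_Im_Ln[of "exp \<zeta>"] Im_Ln_le_pi[of "exp \<zeta>"]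
          by (auto simp: K_def in_cbox_complex_iff)
        moreover have "y = ?f (Ln (exp \<zeta>))"
          unfolding y by (subst untwisted_exp_cong[of \<zeta> "Ln (exp \<zeta>)"]) auto
        ultimately show ?thesis by blast
      qed
    qed
    hence "?f constant_on UNIV"
      using bd by (intro Liouville_theorem untwisted_holomorphic bounded_subset[OF bd])
    thus ?thesis by (auto simp: constant_on_def)
  qed
  thus ?thesis by (simp add: fps_eq_iff untwisted_at_0)
qed

lemma generator_eq: "generator \<zeta> = expmul n (- \<zeta> / tpi) 1"
proof -
  have "expmul n (- \<zeta> / tpi) (untwisted \<zeta>) = generator \<zeta>"
    unfolding untwisted_def by (rule expmul_cancel[OF period_cx[OF generator(1)]]) simp
  thus ?thesis by (simp add: untwisted_eq_1)
qed

section \<open>The Hodge filtration over the universal cover\<close>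

lemma transversality:
  assumes "0 \<notin> ball a r" "finite B" "B \<subseteq> cx (fibre V a)"
    and "\<And>b. b \<in> B \<Longrightarrow> c b holomorphic_on ball a r"
    and "\<And>z. z \<in> ball a r \<Longrightarrow> (\<Sum>b\<in>B. c b z *\<^sub>C b) \<in> flat_hdg V a p z" and "z \<in> ball a r"
  shows "(\<Sum>b\<in>B. deriv (c b) z *\<^sub>C b) \<in> flat_hdg V a (p - 1) z"
  by (rule vmhs[unfolded vmhs_def, THEN conjunct2, THEN conjunct2, THEN conjunct2, rule_format, OF assms])

text \<open>
  Near \<open>\<alpha>\<close> the section \<open>e\<^sup>i exp (\<kappa>(z) e)\<close> with \<open>\<kappa>(z) = -(\<alpha> + log (z / exp \<alpha>)) / 2\<pi>i\<close> lies in \<open>F\<^sup>-\<^sup>i\<close> by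
  induction; its derivative is \<open>\<kappa>'(z) e\<^sup>i\<^sup>+\<^sup>1 exp (\<kappa>(z) e)\<close> with \<open>\<kappa>' \<noteq> 0\<close>, and lies in \<open>F\<^sup>-\<^sup>i\<^sup>-\<^sup>1\<close> by Griffiths
  transversality.
\<close>

lemma tower_in_period: "expmul n (- \<zeta> / tpi) (fps_X ^ i) \<in> period \<zeta> (- int i)"
proof (induction i arbitrary: \<zeta>)
  case 0
  show ?case using generator(1)[of \<zeta>] by (simp add: generator_eq)
next
  case (Suc i \<alpha>)
  let ?a = "exp \<alpha>"
  define r where "r = norm ?a"
  define \<kappa> where "\<kappa> z = - (\<alpha> + Ln (z / ?a)) / tpi" for z
  define c where "c j z = fps_nth (expmul n (\<kappa> z) (fps_X ^ i)) j" for j z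
  define B where "B = (\<lambda>j. flat \<alpha> (fps_X ^ j)) ` {..n}"
  define idx where "idx = inv_into {..n} (\<lambda>j. flat \<alpha> (fps_X ^ j))"
  have X_cx: "fps_X ^ j \<in> cx (Uhat n)" if "j \<le> n" for j
    using that by (auto simp: cx_Uhat fps_X_power_nth)
  have inj: "inj_on (\<lambda>j. flat \<alpha> (fps_X ^ j)) {..n}"
  proof (rule inj_onI)
    fix j k assume "j \<in> {..n}" "k \<in> {..n}" "flat \<alpha> (fps_X ^ j) = flat \<alpha> (fps_X ^ k)"
    hence "fps_X ^ j = (fps_X ^ k :: complex fps)" by (simp add: flat_eq_iff X_cx)
    hence "fps_nth (fps_X ^ j) j = fps_nth (fps_X ^ k :: complex fps) j" by simp
    thus "j = k" by (simp add: fps_X_power_nth split: if_splits)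
  qed
  have idx: "idx (flat \<alpha> (fps_X ^ j)) = j" if "j \<le> n" for j
    unfolding idx_def using that by (intro inv_into_f_eq[OF inj]) auto
  have sum_B: "(\<Sum>b\<in>B. f (idx b) *\<^sub>C b) = flat \<alpha> (\<Sum>j\<le>n. f j *\<^sub>C fps_X ^ j)" for f
  proof -
    have "(\<Sum>b\<in>B. f (idx b) *\<^sub>C b) = (\<Sum>j\<le>n. f j *\<^sub>C flat \<alpha> (fps_X ^ j))"
      unfolding B_def by (simp add: sum.reindex[OF inj] idx)
    also have "\<dots> = flat \<alpha> (\<Sum>j\<le>n. f j *\<^sub>C fps_X ^ j)"
      using X_cx by (intro clinear_on_sum[OF clinear_flat, symmetric]) auto
    finally show ?thesis .
  qed
  have r: "0 \<notin> ball ?a r" by (simp add: r_def)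
  have a: "?a \<in> ball ?a r" by (simp add: r_def)
  have quot: "z / ?a \<notin> \<real>\<^sub>\<le>\<^sub>0" if "z \<in> ball ?a r" for z
    using divide_in_ball_1[OF r that] by (rule ball_1_slit)
  have \<kappa>_deriv: "(\<kappa> has_field_derivative (- 1 / (tpi * z))) (at z)" if z: "z \<in> ball ?a r" for z
  proof -
    have "z \<noteq> 0" using quot[OF z] by auto
    thus ?thesis
      unfolding \<kappa>_def[abs_def] using quot[OF z]
      by (auto intro!: derivative_eq_intros simp: field_simps)
  qed
  have \<kappa>_hol: "\<kappa> holomorphic_on ball ?a r"
    unfolding holomorphic_on_open[OF open_ball] using \<kappa>_deriv by blast
  have c_hol: "c j holomorphic_on ball ?a r" for j
    unfolding c_def[abs_def] nth_expmul_power
    by (cases "i \<le> j \<and> j \<le> n") (auto intro!: holomorphic_intros \<kappa>_hol)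
  have c_deriv: "deriv (c j) ?a = (- 1 / (tpi * ?a)) * fps_nth (expmul n (\<kappa> ?a) (fps_X ^ Suc i)) j" for j
  proof (cases "Suc i \<le> j \<and> j \<le> n")
    case True
    then obtain m where m: "j - i = Suc m" "j - Suc i = m" by (metis Suc_diff_Suc Suc_le_lessD)
    have "((\<lambda>z. \<kappa> z ^ Suc m / fact (Suc m)) has_field_derivative
        (of_nat (Suc m) * \<kappa> ?a ^ m * (- 1 / (tpi * ?a)) / fact (Suc m))) (at ?a)"
      by (rule DERIV_cdivide) (use DERIV_power[OF \<kappa>_deriv[OF a], of "Suc m"] in \<open>simp add: mult_ac\<close>)
    moreover have "of_nat (Suc m) * x * y / fact (Suc m) = y * (x / fact m)" for x y :: complex
    proof -
      have "fact (Suc m) = (of_nat (Suc m) * fact m :: complex)" by (simp only: fact_Suc)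
      thus ?thesis by (simp del: of_nat_Suc fact_Suc)
    qed
    moreover have "c j = (\<lambda>z. \<kappa> z ^ Suc m / fact (Suc m))"
      using True m by (simp add: c_def[abs_def] nth_expmul_power del: power_Suc fact_Suc)
    ultimately have "deriv (c j) ?a = (- 1 / (tpi * ?a)) * (\<kappa> ?a ^ m / fact m)"
      by (metis DERIV_imp_deriv)
    thus ?thesis using True m by (simp add: nth_expmul_power del: power_Suc)
  next
    case False
    have "c j = (\<lambda>z. if j = i \<and> j \<le> n then 1 else 0)"
      using False by (auto simp: c_def[abs_def] nth_expmul_power fun_eq_iff not_le le_less_Suc_eq)
    thus ?thesis using False by (auto simp: nth_expmul_power simp del: power_Suc)
  qed
  have "(\<Sum>b\<in>B. c (idx b) z *\<^sub>C b) \<in> flat_hdg V ?a (- int i) z" if z: "z \<in> ball ?a r" for z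
  proof -
    have "(\<Sum>b\<in>B. c (idx b) z *\<^sub>C b) = flat \<alpha> (expmul n (\<kappa> z) (fps_X ^ i))"
      unfolding sum_B[of "\<lambda>j. c j z"] by (simp add: c_def cx_Uhat_expand)
    thus ?thesis
      unfolding flat_hdg_eq[OF r z] \<kappa>_def using Suc.IH[of "\<alpha> + Ln (z / ?a)"] by (simp only: imageI)
  qed
  moreover have "finite B" "B \<subseteq> cx (fibre V ?a)"
    using X_cx flat_in by (auto simp: B_def)
  ultimately have "(\<Sum>b\<in>B. deriv (c (idx b)) ?a *\<^sub>C b) \<in> flat_hdg V ?a (- int i - 1) ?a"
    using r a c_hol by (intro transversality) blast+
  also have "(\<Sum>b\<in>B. deriv (c (idx b)) ?a *\<^sub>C b) =
      flat \<alpha> ((- 1 / (tpi * ?a)) *\<^sub>C expmul n (\<kappa> ?a) (fps_X ^ Suc i))"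
  proof -
    have "(\<Sum>j\<le>n. deriv (c j) ?a *\<^sub>C fps_X ^ j) =
        (- 1 / (tpi * ?a)) *\<^sub>C (\<Sum>j\<le>n. fps_nth (expmul n (\<kappa> ?a) (fps_X ^ Suc i)) j *\<^sub>C fps_X ^ j)"
      by (simp only: c_deriv cvec.scale_sum_right cvec.scale_scale)
    also have "(\<Sum>j\<le>n. fps_nth (expmul n (\<kappa> ?a) (fps_X ^ Suc i)) j *\<^sub>C fps_X ^ j) =
        expmul n (\<kappa> ?a) (fps_X ^ Suc i)"
      by (rule cx_Uhat_expand) (rule expmul_in_cx)
    finally show ?thesis
      unfolding sum_B[of "\<lambda>j. deriv (c j) ?a"] by (rule arg_cong)
  qed
  also have "flat_hdg V ?a (- int i - 1) ?a = flat \<alpha> ` period \<alpha> (- int (Suc i))"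
  proof -
    have "- int (Suc i) = - int i - 1" by simp
    thus ?thesis using flat_hdg_eq[OF r a, of "- int i - 1"] by (simp only: divide_self_if exp_not_eq_zero) simp
  qed
  finally have "flat \<alpha> ((- 1 / (tpi * ?a)) *\<^sub>C expmul n (\<kappa> ?a) (fps_X ^ Suc i)) \<in>
      flat \<alpha> ` period \<alpha> (- int (Suc i))" .
  moreover have "(- 1 / (tpi * ?a)) *\<^sub>C expmul n (\<kappa> ?a) (fps_X ^ Suc i) \<in> cx (Uhat n)"
    by (intro cvec.subspace_scale subspace_cx expmul_in_cx)
  moreover have "period \<alpha> (- int (Suc i)) \<subseteq> cx (Uhat n)" using period_cx by blast
  ultimately have "(- 1 / (tpi * ?a)) *\<^sub>C expmul n (\<kappa> ?a) (fps_X ^ Suc i) \<in> period \<alpha> (- int (Suc i))"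
    using inj_on_image_mem_iff[OF inj_flat] by blast
  hence "(- (tpi * ?a)) *\<^sub>C (- 1 / (tpi * ?a)) *\<^sub>C expmul n (\<kappa> ?a) (fps_X ^ Suc i) \<in> period \<alpha> (- int (Suc i))"
    by (rule cvec.subspace_scale[OF subspace_period])
  thus ?case by (simp add: \<kappa>_def del: power_Suc of_nat_Suc)
qed

text \<open>
  The inclusion of \<open>exp (-(\<zeta>/2\<pi>i) e) F\<^sub>0\<close> in \<open>F\<^sub>\<zeta>\<close> comes from the powers of \<open>e\<close>. Conversely, after
  subtracting from an element of \<open>F\<^sup>p\<^sub>\<zeta>\<close> the part thus accounted for, what is left has only
  coefficients of index \<open>j > -p\<close>, and no non-zero element of \<open>F\<^sup>p\<^sub>\<zeta>\<close> has this shape.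
\<close>

lemma mem_period_iff:
  "u \<in> period \<zeta> p \<longleftrightarrow> u \<in> cx (Uhat n) \<and> expmul n (\<zeta> / tpi) u \<in> hdg (Uhat n) p"
proof -
  let ?c = "\<zeta> / tpi"
  have back_in: "expmul n (- ?c) w \<in> period \<zeta> p" if w: "w \<in> hdg (Uhat n) p" for w
  proof -
    have "w \<in> cx (Uhat n)"
      using w hdg_Uhat_subset by blast
    hence "w = (\<Sum>i\<le>n. fps_nth w i *\<^sub>C fps_X ^ i)"
      by (rule cx_Uhat_expand[symmetric])
    hence "expmul n (- ?c) w = (\<Sum>i\<le>n. fps_nth w i *\<^sub>C expmul n (- ?c) (fps_X ^ i))"
      using clinear_on_sum[OF clinear_expmul[of UNIV], of "{..n}" "\<lambda>i. fps_X ^ i" n "- ?c" "fps_nth w"]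
      by simp
    also have "\<dots> \<in> period \<zeta> p"
    proof (rule cvec.subspace_sum[OF subspace_period])
      fix i
      show "fps_nth w i *\<^sub>C expmul n (- ?c) (fps_X ^ i) \<in> period \<zeta> p"
      proof (cases "fps_nth w i = 0")
        case False
        hence "p \<le> - int i" using w by (auto simp: hdg_Uhat)
        hence "expmul n (- ?c) (fps_X ^ i) \<in> period \<zeta> p"
          using tower_in_period[of \<zeta> i] period_antimono by auto
        thus ?thesis by (rule cvec.subspace_scale[OF subspace_period])
      qed (simp add: cvec.subspace_0[OF subspace_period])
    qed
    finally show ?thesis .
  qed
  show ?thesis
  proof
    assume u: "u \<in> period \<zeta> p"
    let ?w = "expmul n ?c u"
    define w1 where "w1 = Abs_fps (\<lambda>i. if p \<le> - int i then fps_nth ?w i else 0)"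
    have w1: "w1 \<in> hdg (Uhat n) p"
      by (auto simp: w1_def hdg_Uhat nth_expmul)
    let ?d = "expmul n (- ?c) (?w - w1)"
    have "?d = u - expmul n (- ?c) w1"
    proof -
      have "?d = expmul n (- ?c) ?w - expmul n (- ?c) w1"
        by (rule clinear_on_diff[OF clinear_expmul[of UNIV]]) auto
      thus ?thesis using period_cx[OF u] by (simp add: expmul_cancel)
    qed
    hence "?d \<in> period \<zeta> p"
      using cvec.subspace_diff[OF subspace_period u back_in[OF w1]] by simp
    moreover have "- int j < p" if "fps_nth ?d j \<noteq> 0" for j
    proof (rule ccontr)
      assume "\<not> - int j < p"
      hence "fps_nth (?w - w1) i = 0" if "i \<le> j" for i
        using that by (simp add: w1_def)
      hence "fps_nth ?d j = 0" by (simp add: nth_expmul)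
      thus False using that by simp
    qed
    ultimately have "?d = 0" by (rule period_eq_0)
    hence "expmul n ?c ?d = 0" by (simp add: expmul_def)
    moreover have "?w - w1 \<in> cx (Uhat n)"
      using w1 hdg_Uhat_subset by (intro cvec.subspace_diff) auto
    ultimately have "?w = w1" by (simp add: expmul_cancel)
    thus "u \<in> cx (Uhat n) \<and> ?w \<in> hdg (Uhat n) p" using w1 period_cx[OF u] by simp
  next
    assume u: "u \<in> cx (Uhat n) \<and> expmul n ?c u \<in> hdg (Uhat n) p"
    thus "u \<in> period \<zeta> p" using back_in[of "expmul n ?c u"] by (simp add: expmul_cancel)
  qed
qed

section \<open>The splitting over a root of unity\<close>

definition splitting :: "complex \<Rightarrow> 'v \<Rightarrow> nat \<Rightarrow> complex"
  where "splitting \<kappa> x = fps_nth (expmul n \<kappa> (inv_into (cx (Uhat n)) (flat (\<kappa> * tpi)) x))"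

lemma splitting_flat: "u \<in> cx (Uhat n) \<Longrightarrow> splitting \<kappa> (flat (\<kappa> * tpi) u) = fps_nth (expmul n \<kappa> u)"
  by (simp add: splitting_def inv_into_f_f[OF inj_flat])

text \<open>
  Rationality of \<open>\<kappa>\<close> makes \<open>exp (\<kappa>e)\<close> preserve the lattice; it takes \<open>F\<^sub>\<zeta>\<close> to the split filtration
  at \<open>\<zeta> = 2\<pi>i\<kappa>\<close> in any case.
\<close>

lemma splitting_iso:
  assumes \<kappa>: "\<kappa> \<in> \<rat>"
  shows "mhs_iso (fibre V (exp (\<kappa> * tpi))) (tate_sum n) (splitting \<kappa>)"
proof (rule mhs_isoI)
  let ?M = "fibre V (exp (\<kappa> * tpi))"
  have img: "splitting \<kappa> ` flat (\<kappa> * tpi) ` S = fps_nth ` expmul n \<kappa> ` S" if "S \<subseteq> cx (Uhat n)" for S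
    using that by (auto simp: image_image splitting_flat subset_iff intro!: image_cong)
  have cxM: "cx ?M = flat (\<kappa> * tpi) ` cx (Uhat n)" by (simp add: flat_cx)
  have \<kappa>': "- \<kappa> \<in> \<rat>" using \<kappa> by simp
  show "clinear_on (cx ?M) (splitting \<kappa>)"
    unfolding clinear_on_def
  proof (intro conjI ballI allI)
    fix x y assume "x \<in> cx ?M" "y \<in> cx ?M"
    then obtain u v where uv: "u \<in> cx (Uhat n)" "v \<in> cx (Uhat n)"
        "x = flat (\<kappa> * tpi) u" "y = flat (\<kappa> * tpi) v" by (auto simp: cxM)
    have "x + y = flat (\<kappa> * tpi) (u + v)" using uv by (simp add: clinear_on_add[OF clinear_flat])
    thus "splitting \<kappa> (x + y) = splitting \<kappa> x + splitting \<kappa> y"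
      using uv by (simp add: splitting_flat cvec.subspace_add plus_fun_def fun_eq_iff
          clinear_on_add[OF clinear_expmul[of UNIV]])
  next
    fix a x assume "x \<in> cx ?M"
    then obtain u where u: "u \<in> cx (Uhat n)" "x = flat (\<kappa> * tpi) u" by (auto simp: cxM)
    have "a *\<^sub>C x = flat (\<kappa> * tpi) (a *\<^sub>C u)" using u by (simp add: clinear_on_scale[OF clinear_flat])
    thus "splitting \<kappa> (a *\<^sub>C x) = a *\<^sub>C splitting \<kappa> x"
      using u by (simp add: splitting_flat cvec.subspace_scale scaleC_fun_def scaleC_complex_def
          fun_eq_iff clinear_on_scale[OF clinear_expmul[of UNIV]])
  qed
  have "splitting \<kappa> ` cx ?M = cx (tate_sum n)"
    unfolding cxM using expmul_image[of "cx (Uhat n)" n \<kappa> "cx (Uhat n)"] by (simp add: img cx_tate_sum)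
  moreover have "inj_on (splitting \<kappa>) (cx ?M)"
  proof (rule inj_onI)
    fix x y assume "x \<in> cx ?M" "y \<in> cx ?M" "splitting \<kappa> x = splitting \<kappa> y"
    then obtain u v where uv: "u \<in> cx (Uhat n)" "v \<in> cx (Uhat n)"
        "x = flat (\<kappa> * tpi) u" "y = flat (\<kappa> * tpi) v" "expmul n \<kappa> u = expmul n \<kappa> v"
      by (auto simp: cxM splitting_flat fps_nth_inject)
    have "expmul n (- \<kappa>) (expmul n \<kappa> u) = expmul n (- \<kappa>) (expmul n \<kappa> v)" using uv(5) by simp
    hence "u = v" using uv(1,2) by (simp add: expmul_cancel)
    thus "x = y" using uv(3,4) by simp
  qed
  ultimately show "bij_betw (splitting \<kappa>) (cx ?M) (cx (tate_sum n))" by (simp add: bij_betw_def)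
  have lat: "lattice (Uhat n) \<subseteq> cx (Uhat n)" by (auto simp: lattice_Uhat cx_Uhat)
  hence "expmul n \<kappa> ` lattice (Uhat n) = lattice (Uhat n)"
    using \<kappa> \<kappa>' by (intro expmul_image) (auto intro: expmul_lattice)
  thus "splitting \<kappa> ` lattice ?M = lattice (tate_sum n)"
    unfolding flat_lattice[symmetric] by (simp add: img lat) (simp add: Uhat_def fps_nth_image_Abs_fps)
  have "expmul n \<kappa> ` wt (Uhat n) k = wt (Uhat n) k" for k
    using \<kappa> \<kappa>' wt_Uhat_subset by (intro expmul_image) (auto intro: expmul_wt)
  thus "splitting \<kappa> ` wt ?M k = wt (tate_sum n) k" for k
    unfolding flat_wt[symmetric] by (simp add: img wt_Uhat_subset) (simp add: Uhat_def fps_nth_image_Abs_fps)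
  have "expmul n \<kappa> ` period (\<kappa> * tpi) p = hdg (Uhat n) p" for p
  proof (rule expmul_image)
    show "expmul n (- \<kappa>) u \<in> period (\<kappa> * tpi) p" if "u \<in> hdg (Uhat n) p" for u
      using that subsetD[OF hdg_Uhat_subset that] by (simp add: mem_period_iff expmul_cancel)
  qed (auto simp: mem_period_iff hdg_Uhat_subset)
  thus "splitting \<kappa> ` hdg ?M p = hdg (tate_sum n) p" for p
    unfolding flat_period[symmetric] using period_cx
    by (subst img) (auto simp: Uhat_def fps_nth_image_Abs_fps)
  show "filtrations_inside ?M" by (simp add: inside_fibre)
qed

text \<open>
  The path is arbitrary, but by unipotence replacing it by the exponential path changes the
  transported vector only in lower weight, which the coefficient of \<open>e\<^sup>j\<close> does not see; neither does
  that coefficient see multiplication by \<open>exp (\<kappa>e)\<close>.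
\<close>

lemma splitting_graded:
  assumes g: "Gm_path g" "pathstart g = 1" "pathfinish g = exp (\<kappa> * tpi)"
    and u: "u \<in> wt (Uhat n) (- 2 * int j)"
  shows "splitting \<kappa> (transp V g (\<iota> u)) j = fps_nth u j"
proof -
  let ?\<zeta> = "\<kappa> * tpi"
  have "\<iota> u \<in> wt (fibre V 1) (- 2 * int j)" using u stalkD(4) by blast
  hence "transp V g (\<iota> u) - flat ?\<zeta> u \<in> wt (fibre V (exp ?\<zeta>)) (- 2 * int j - 1)"
    using unipotent g Gm_path_logpath[of ?\<zeta>] unfolding unipotent_vmhs_def flat_def
    by (metis pathstart_logpath pathfinish_logpath)
  then obtain u' where u': "u' \<in> wt (Uhat n) (- 2 * int j - 1)"
      "transp V g (\<iota> u) - flat ?\<zeta> u = flat ?\<zeta> u'"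
    unfolding flat_wt[symmetric] by blast
  have cx: "u \<in> cx (Uhat n)" "u' \<in> cx (Uhat n)" using u u'(1) wt_Uhat_subset by auto
  have "transp V g (\<iota> u) = flat ?\<zeta> u + flat ?\<zeta> u'" using u'(2) by (simp add: algebra_simps)
  also have "\<dots> = flat ?\<zeta> (u + u')" using cx by (simp add: clinear_on_add[OF clinear_flat])
  finally have eq: "splitting \<kappa> (transp V g (\<iota> u)) = fps_nth (expmul n \<kappa> (u + u'))"
    using cx by (simp add: splitting_flat cvec.subspace_add)
  show ?thesis
  proof (cases "j \<le> n")
    case True
    have zero: "fps_nth u i = 0" "fps_nth u' i = 0" if "i < j" for i
      using that True u u'(1) by (auto simp: wt_Uhat)
    have "fps_nth u' j = 0" using True u'(1) by (simp add: wt_Uhat)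
    thus ?thesis unfolding eq using True zero by (subst nth_expmul_leading) auto
  next
    case False
    thus ?thesis using cx(1) by (simp add: eq nth_expmul cx_Uhat)
  qed
qed

text \<open>
  The vectors \<open>exp (-\<kappa>e) e\<^sup>j\<close> span the fibre. Each lies in \<open>F\<^sup>-\<^sup>j \<inter> W\<^sub>-\<^sub>2\<^sub>j\<close>, so its image lies in the summand
  \<open>\<rat>(j)\<close>, where it is determined by the prescribed coefficient.
\<close>

lemma splitting_unique:
  assumes \<kappa>: "\<kappa> \<in> \<rat>" and \<psi>: "mhs_hom (fibre V (exp (\<kappa> * tpi))) (tate_sum n) \<psi>"
    and gr: "\<And>j u. u \<in> wt (Uhat n) (- 2 * int j) \<Longrightarrow> \<psi> (flat (\<kappa> * tpi) u) j = fps_nth u j"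
    and x: "x \<in> cx (fibre V (exp (\<kappa> * tpi)))"
  shows "\<psi> x = splitting \<kappa> x"
proof -
  let ?\<zeta> = "\<kappa> * tpi"
  have \<psi>_linear: "clinear_on (cx (fibre V (exp ?\<zeta>))) \<psi>" using \<psi> by (simp add: mhs_hom_def)
  define e where "e j = expmul n (- \<kappa>) (fps_X ^ j)" for j
  have e_cx: "e j \<in> cx (Uhat n)" for j by (simp add: e_def)
  have \<psi>_e: "\<psi> (flat ?\<zeta> (e j)) i = (if i = j then 1 else 0)" if j: "j \<le> n" for i j
  proof -
    have wt: "e j \<in> wt (Uhat n) (- 2 * int j)"
      unfolding e_def using \<kappa> j by (intro expmul_wt) (auto simp: wt_Uhat fps_X_power_nth)
    have per: "e j \<in> period ?\<zeta> (- int j)"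
      using tower_in_period[of ?\<zeta> j] by (simp add: e_def)
    have "flat ?\<zeta> (e j) \<in> wt (fibre V (exp ?\<zeta>)) (- 2 * int j)"
      "flat ?\<zeta> (e j) \<in> hdg (fibre V (exp ?\<zeta>)) (- int j)"
      using wt per flat_wt flat_period by blast+
    hence "\<psi> (flat ?\<zeta> (e j)) \<in> wt (tate_sum n) (- 2 * int j)"
      "\<psi> (flat ?\<zeta> (e j)) \<in> hdg (tate_sum n) (- int j)"
      using \<psi> unfolding mhs_hom_def by blast+
    hence "\<psi> (flat ?\<zeta> (e j)) i = 0" if "i \<noteq> j"
      using that by (cases "i < j") (auto simp: wt_tate_sum hdg_tate_sum)
    moreover have "\<psi> (flat ?\<zeta> (e j)) j = 1"
      using gr[OF wt] j by (simp add: e_def nth_expmul_power)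
    ultimately show ?thesis by simp
  qed
  obtain u where u: "u \<in> cx (Uhat n)" "x = flat ?\<zeta> u" using x flat_cx by blast
  define w where "w = expmul n \<kappa> u"
  have w: "w = (\<Sum>j\<le>n. fps_nth w j *\<^sub>C fps_X ^ j)"
    by (rule cx_Uhat_expand[symmetric]) (simp add: w_def)
  have "u = expmul n (- \<kappa>) w" using u(1) by (simp add: w_def expmul_cancel)
  also have "\<dots> = (\<Sum>j\<le>n. fps_nth w j *\<^sub>C e j)"
    unfolding e_def by (subst w) (rule clinear_on_sum[OF clinear_expmul[of UNIV]], auto)
  finally have "x = (\<Sum>j\<le>n. fps_nth w j *\<^sub>C flat ?\<zeta> (e j))"
    using u(2) by (simp add: clinear_on_sum[OF clinear_flat] e_cx)
  hence "\<psi> x = (\<Sum>j\<le>n. fps_nth w j *\<^sub>C \<psi> (flat ?\<zeta> (e j)))"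
    using flat_in[OF e_cx] by (simp add: clinear_on_sum[OF \<psi>_linear])
  moreover have "(\<Sum>j\<le>n. fps_nth w j *\<^sub>C \<psi> (flat ?\<zeta> (e j))) i = fps_nth w i" for i
  proof -
    have "(\<Sum>j\<in>A. f j) i = (\<Sum>j\<in>A. f j i)" for A :: "nat set" and f :: "nat \<Rightarrow> nat \<Rightarrow> complex"
      by (induction A rule: infinite_finite_induct) auto
    hence "(\<Sum>j\<le>n. fps_nth w j *\<^sub>C \<psi> (flat ?\<zeta> (e j))) i = (\<Sum>j\<le>n. fps_nth w j * \<psi> (flat ?\<zeta> (e j)) i)"
      by (simp add: scaleC_fun_def scaleC_complex_def)
    also have "\<dots> = (\<Sum>j\<le>n. if i = j then fps_nth w j else 0)"
      by (intro sum.cong) (auto simp: \<psi>_e)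
    also have "\<dots> = fps_nth w i" by (simp add: w_def nth_expmul)
    finally show ?thesis .
  qed
  ultimately show ?thesis using u by (simp add: splitting_flat w_def fun_eq_iff)
qed

end

theorem propositionV1p1:
  fixes L :: "nat \<Rightarrow> 'v::complex_vector variation"
    and q :: "nat \<Rightarrow> complex \<Rightarrow> 'v \<Rightarrow> 'v"
    and \<iota> :: "nat \<Rightarrow> complex fps \<Rightarrow> 'v"
    and \<omega> :: complex and m :: nat
  assumes "logarithmic_sheaf L q \<iota>"
    and "m > 0" and "\<omega> ^ m = 1"
  shows "\<exists>\<phi>. canonical_splitting L q \<iota> \<omega> \<phi> \<and>
           (\<forall>\<psi>. canonical_splitting L q \<iota> \<omega> \<psi> \<longrightarrow>
              (\<forall>n. \<forall>x\<in>cx (fibre (L n) \<omega>). \<psi> n x = \<phi> n x))"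
proof -
  let ?tpi = "2 * of_real pi * \<i> :: complex"
  obtain \<kappa> where \<kappa>: "\<kappa> \<in> \<rat>" "exp (\<kappa> * ?tpi) = \<omega>"
    using root_of_unity_exp[OF assms(2,3)] .
  have lv: "log_variation (L n) n (\<iota> n)" for n
    using assms(1) unfolding logarithmic_sheaf_def by (intro log_variation.intro) blast+
  define \<phi> where "\<phi> n = log_variation.splitting (L n) n (\<iota> n) \<kappa>" for n
  have flat: "log_variation.flat (L n) (\<iota> n) (\<kappa> * ?tpi) u = transp (L n) (logpath (\<kappa> * ?tpi)) (\<iota> n u)" for n u
    by (rule log_variation.flat_def[OF lv])
  have compat: "\<phi> n (q n \<omega> x) = tate_proj n (\<phi> (Suc n) x)" if x: "x \<in> cx (fibre (L (Suc n)) \<omega>)" for n x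
  proof -
    interpret A: log_variation "L n" n "\<iota> n" by (rule lv)
    interpret B: log_variation "L (Suc n)" "Suc n" "\<iota> (Suc n)" by (rule lv)
    obtain u where u: "u \<in> cx (Uhat (Suc n))" "x = B.flat (\<kappa> * ?tpi) u"
      using x B.flat_cx[of "\<kappa> * ?tpi"] \<kappa>(2) by auto
    have "vmhs_hom (L (Suc n)) (L n) (q n)"
      using assms(1) by (simp add: logarithmic_sheaf_def)
    hence "q n \<omega> x = transp (L n) (logpath (\<kappa> * ?tpi)) (q n 1 (\<iota> (Suc n) u))"
      using B.stalk_in[OF u(1)] Gm_path_logpath[of "\<kappa> * ?tpi"] \<kappa>(2)
      unfolding vmhs_hom_def u(2) B.flat_def
      by (metis pathstart_logpath pathfinish_logpath)
    also have "q n 1 (\<iota> (Suc n) u) = \<iota> n (fps_cutoff (Suc n) u)"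
      using assms(1) u(1) by (simp add: logarithmic_sheaf_def)
    finally have "q n \<omega> x = A.flat (\<kappa> * ?tpi) (fps_cutoff (Suc n) u)" by (simp add: A.flat_def)
    hence "\<phi> n (q n \<omega> x) = fps_nth (expmul n \<kappa> (fps_cutoff (Suc n) u))"
      by (simp add: \<phi>_def A.splitting_flat)
    also have "expmul n \<kappa> (fps_cutoff (Suc n) u) = expmul n \<kappa> u"
      by (simp add: expmul_def cutoff_mult_cutoff)
    also have "fps_nth (expmul n \<kappa> u) = tate_proj n (fps_nth (expmul (Suc n) \<kappa> u))"
      by (auto simp: tate_proj_def expmul_def)
    also have "fps_nth (expmul (Suc n) \<kappa> u) = \<phi> (Suc n) x"
      using u by (simp add: \<phi>_def B.splitting_flat)
    finally show ?thesis .
  qed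
  have "canonical_splitting L q \<iota> \<omega> \<phi>"
    unfolding canonical_splitting_def
    using log_variation.splitting_iso[OF lv \<kappa>(1)] log_variation.splitting_graded[OF lv, where \<kappa> = \<kappa>] compat
    by (simp add: \<phi>_def \<kappa>(2))
  moreover have "\<psi> n x = \<phi> n x"
    if \<psi>: "canonical_splitting L q \<iota> \<omega> \<psi>" and x: "x \<in> cx (fibre (L n) \<omega>)" for \<psi> n x
    unfolding \<phi>_def
  proof (rule log_variation.splitting_unique[OF lv \<kappa>(1)])
    show "mhs_hom (fibre (L n) (exp (\<kappa> * ?tpi))) (tate_sum n) (\<psi> n)"
      using \<psi> by (simp add: canonical_splitting_def mhs_iso_def \<kappa>(2))
    show "\<psi> n (log_variation.flat (L n) (\<iota> n) (\<kappa> * ?tpi) u) j = fps_nth u j"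
      if "u \<in> wt (Uhat n) (- 2 * int j)" for j u
      using \<psi> that \<kappa>(2) unfolding flat canonical_splitting_def by simp
  qed (use x \<kappa>(2) in simp)
  ultimately show ?thesis by blast
qed

end
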